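(* Let $S=\prod_{i=1}^n S_i$ be a finite product of Polish spaces endowed with the product Borel sigma algebra and a product Borel probability measure $P=\prod_{i=1}^n P_i$, and let $A$ and $B$ be Borel subsets of $S$. Then the set $A\,\Box\,B$ is measurable with respect to the completion $\overline P$ of $P$, and $$\overline P(A\,\Box\,B)\le P(A)P(B).$$
   Context: Notation: $[n]=\{1,\dots,n\}$. For $K\subseteq[n]$ and $\mathbf x\in S$, the $K$-cylinder of $\mathbf x$ is $[\mathbf x]_K=\{\mathbf y\in S:y_i=x_i\ \forall i\in K\}$. The box operation is $$A\,\Box\,B=\{\mathbf x\in S:\text{there exist disjoint }K,L\subseteq[n]\text{ such that }[\mathbf x]_K\subseteq A,\ [\mathbf x]_L\subseteq B\}.$$ Measurability with respect to $\overline P$ means membership in the completion of the product Borel sigma algebra with respect to $P$. *)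

theory Defs
  imports "HOL-Probability.Probability"
begin

(* The library's class polish_space fixes one Polish space per type.  Abstract topologies are used
   instead, so that the factors of a product may be different Polish spaces. *)
definition polish_topology :: "'a topology \<Rightarrow> bool" where
  "polish_topology X \<longleftrightarrow> completely_metrizable_space X \<and> separable_space X"

(* Only the space and the sets of this measure matter; as a measure it is zero. *)
definition borel_of :: "'a topology \<Rightarrow> 'a measure" where
  "borel_of X = sigma (topspace X) {U. openin X U}"

definition cylinder :: "(nat \<Rightarrow> 'a) set \<Rightarrow> nat set \<Rightarrow> (nat \<Rightarrow> 'a) \<Rightarrow> (nat \<Rightarrow> 'a) set" where
  "cylinder S K x = {y \<in> S. \<forall>i\<in>K. y i = x i}"

definition box_op ::
  "nat \<Rightarrow> (nat \<Rightarrow> 'a) set \<Rightarrow> (nat \<Rightarrow> 'a) set \<Rightarrow> (nat \<Rightarrow> 'a) set \<Rightarrow> (nat \<Rightarrow> 'a) set" where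
  "box_op n S A B =
     {x \<in> S. \<exists>K L. K \<subseteq> {1..n} \<and> L \<subseteq> {1..n} \<and> K \<inter> L = {} \<and>
                   cylinder S K x \<subseteq> A \<and> cylinder S L x \<subseteq> B}"

end

(* For \<open>K \<subseteq> {1..n}\<close> let \<open>A_K\<close> be the set of all \<open>x\<close> whose \<open>K\<close>-cylinder lies in \<open>A\<close>; then the box of \<open>A\<close>
   and \<open>B\<close> is the union over \<open>K\<close> of the intersections of \<open>A_K\<close> with \<open>B_L\<close>, \<open>L\<close> the complement of \<open>K\<close>.
   The complement of \<open>A_K\<close> is the preimage of a projection of a Borel set in a product of Polish
   spaces. Parametrising the projected factors by Baire space makes the projection a Souslin set,
   hence measurable for the completion, so \<open>A_K\<close> contains, up to a null set, a measurable set that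
   depends on the coordinates in \<open>K\<close> only.

   For such measurable sets the inequality is reduced to Reimer's butterfly theorem on the cube:
   draw two independent points \<open>u, v\<close> and let \<open>x(z)\<close> take its coordinates in \<open>z\<close> from \<open>u\<close> and the others
   from \<open>v\<close>. Each \<open>x(z)\<close> has law \<open>P\<close>, and \<open>x(z)\<close> is independent of \<open>x\<close> at the complement of \<open>z\<close>, so the
   expectation of the butterfly inequality for the random set of all \<open>z\<close> with \<open>x(z)\<close> in the box is the
   claim. *)
theory Submission
  imports Defs
begin

section \<open>Reimer's butterfly theorem\<close>

text \<open>Gaussian elimination without division, by induction on the equations: subtracting cross
  multiples of the pivot equation keeps all coefficients integral.\<close>

lemma int_linear_dependence:
  fixes M :: "'a \<Rightarrow> 'b \<Rightarrow> int"
  assumes "finite R" "finite C" "card R < card C"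
  shows "\<exists>a. (\<exists>j\<in>C. a j \<noteq> 0) \<and> (\<forall>i\<in>R. (\<Sum>j\<in>C. a j * M i j) = 0)"
  using assms
proof (induction R arbitrary: C M rule: finite_induct)
  case empty
  then have "C \<noteq> {}" by auto
  then show ?case by (intro exI[of _ "\<lambda>_. 1"]) auto
next
  case (insert r R)
  show ?case
  proof (cases "\<forall>j\<in>C. M r j = 0")
    case True
    then show ?thesis
      using insert.IH[of C M] insert.prems insert.hyps by auto
  next
    case False
    then obtain p where p: "p \<in> C" "M r p \<noteq> 0" by auto
    define C' where "C' = C - {p}"
    have C: "C = insert p C'" "p \<notin> C'" "finite C'" using p insert.prems by (auto simp: C'_def)
    have "card R < card C'" using insert C by auto
    then obtain a where a: "\<exists>j\<in>C'. a j \<noteq> 0"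
      "\<forall>i\<in>R. (\<Sum>j\<in>C'. a j * (M r p * M i j - M i p * M r j)) = 0"
      using insert.IH[of C' "\<lambda>i j. M r p * M i j - M i p * M r j"] C by auto
    \<comment> \<open>Scaling the reduced solution by the pivot \<open>M r p\<close> leaves room for
      an integral value at \<open>p\<close>, chosen so that equation \<open>r\<close> holds; the
      reduced equations then give the others.\<close>
    define b where "b j = (if j = p then - (\<Sum>j\<in>C'. a j * M r j) else M r p * a j)" for j
    have sum_b: "(\<Sum>j\<in>C. b j * M i j)
        = - (\<Sum>j\<in>C'. a j * M r j) * M i p + M r p * (\<Sum>j\<in>C'. a j * M i j)" for i
    proof -
      have "(\<Sum>j\<in>C'. b j * M i j) = (\<Sum>j\<in>C'. M r p * (a j * M i j))"
        using C by (intro sum.cong) (auto simp: b_def)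
      then show ?thesis using C by (simp add: b_def sum_distrib_left)
    qed
    have "(\<Sum>j\<in>C. b j * M i j) = 0" if "i \<in> R" for i
    proof -
      have "(\<Sum>j\<in>C'. a j * (M r p * M i j - M i p * M r j))
          = M r p * (\<Sum>j\<in>C'. a j * M i j) - (\<Sum>j\<in>C'. a j * M r j) * M i p"
        by (simp add: algebra_simps sum_subtractf sum_distrib_left sum_distrib_right)
      with a that show ?thesis by (simp add: sum_b)
    qed
    moreover have "(\<Sum>j\<in>C. b j * M r j) = 0"
      by (simp add: sum_b)
    moreover have "\<exists>j\<in>C. b j \<noteq> 0"
      using a p C by (auto simp: b_def)
    ultimately show ?thesis by auto
  qed
qed

text \<open>With too many vectors, some nontrivial combination of both families vanishes. Its two
  parts \<open>p\<close> and \<open>q\<close> are orthogonal and opposite, so \<open>p\<close> has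
  square norm zero; both parts vanish, against the independence of each family. The disjoint sum
  \<open>X <+> D\<close> keeps an index lying in both sets apart.\<close>

lemma card_add_le_if_orthogonal:
  fixes V W :: "'b \<Rightarrow> 'b \<Rightarrow> int"
  assumes Q: "finite Q" "X \<subseteq> Q" "D \<subseteq> Q"
    and orth: "\<And>x y. x \<in> X \<Longrightarrow> y \<in> D \<Longrightarrow> (\<Sum>z\<in>Q. V x z * W y z) = 0"
    and V: "\<And>a. (\<And>z. z \<in> Q \<Longrightarrow> (\<Sum>x\<in>X. a x * V x z) = 0) \<Longrightarrow> \<forall>x\<in>X. a x = 0"
    and W: "\<And>a. (\<And>z. z \<in> Q \<Longrightarrow> (\<Sum>y\<in>D. a y * W y z) = 0) \<Longrightarrow> \<forall>y\<in>D. a y = 0"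
  shows "card X + card D \<le> card Q"
proof (rule ccontr)
  assume "\<not> ?thesis"
  moreover have fin: "finite X" "finite D" using Q finite_subset by auto
  ultimately have "card Q < card (X <+> D)" by (simp add: card_Plus)
  then obtain a where a: "\<exists>j\<in>X <+> D. a j \<noteq> 0"
    "\<forall>z\<in>Q. (\<Sum>j\<in>X <+> D. a j * (case j of Inl x \<Rightarrow> V x z | Inr y \<Rightarrow> W y z)) = 0"
    using int_linear_dependence[of Q "X <+> D" "\<lambda>z j. case j of Inl x \<Rightarrow> V x z | Inr y \<Rightarrow> W y z"] Q fin
    by auto
  define p where "p z = (\<Sum>x\<in>X. a (Inl x) * V x z)" for z
  define q where "q z = (\<Sum>y\<in>D. a (Inr y) * W y z)" for z
  have pq: "p z + q z = 0" if "z \<in> Q" for z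
    using a(2) that fin by (auto simp: p_def q_def sum.Plus)
  have "(\<Sum>z\<in>Q. p z * q z)
      = (\<Sum>z\<in>Q. \<Sum>x\<in>X. \<Sum>y\<in>D. a (Inl x) * a (Inr y) * (V x z * W y z))"
    unfolding p_def q_def sum_product by (intro sum.cong refl) (simp add: algebra_simps)
  also have "\<dots> = (\<Sum>x\<in>X. \<Sum>z\<in>Q. \<Sum>y\<in>D. a (Inl x) * a (Inr y) * (V x z * W y z))"
    by (rule sum.swap)
  also have "\<dots> = (\<Sum>x\<in>X. \<Sum>y\<in>D. \<Sum>z\<in>Q. a (Inl x) * a (Inr y) * (V x z * W y z))"
    by (intro sum.cong refl sum.swap)
  also have "\<dots> = 0"
    by (simp add: orth flip: sum_distrib_left)
  finally have "(\<Sum>z\<in>Q. p z * p z) = 0"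
    using pq by (auto simp: add_eq_0_iff sum_negf)
  then have p0: "p z = 0" if "z \<in> Q" for z
    using that Q by (subst (asm) sum_nonneg_eq_0_iff) auto
  then have "\<forall>x\<in>X. a (Inl x) = 0"
    by (intro V) (auto simp: p_def)
  moreover have "\<forall>y\<in>D. a (Inr y) = 0"
    using pq p0 by (intro W) (auto simp: q_def)
  ultimately show False using a(1) by auto
qed

text \<open>Infinite descent: modulo \<open>t\<close> the matrix is the identity, so if
  \<open>t ^ k\<close> divides all coefficients, each equation yields \<open>t ^ Suc k\<close>. A
  nonzero integer is not divisible by arbitrarily high powers of \<open>t\<close>.\<close>

lemma zero_if_dvd_system:
  fixes V :: "'b \<Rightarrow> 'b \<Rightarrow> int"
  assumes "finite X" "t > 1"
    and diag: "\<And>x. x \<in> X \<Longrightarrow> V x x = 1"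
    and off: "\<And>x z. x \<in> X \<Longrightarrow> z \<in> X \<Longrightarrow> x \<noteq> z \<Longrightarrow> t dvd V x z"
    and eq: "\<And>z. z \<in> X \<Longrightarrow> (\<Sum>x\<in>X. a x * V x z) = 0"
  shows "\<forall>x\<in>X. a x = 0"
proof -
  have dvd: "\<forall>x\<in>X. t ^ k dvd a x" for k
  proof (induction k)
    case (Suc k)
    show ?case
    proof
      fix z assume z: "z \<in> X"
      have "a z = - (\<Sum>x\<in>X-{z}. a x * V x z)"
        using eq[OF z] z assms(1) diag by (simp add: sum.remove[of _ z])
      moreover have "t ^ Suc k dvd (\<Sum>x\<in>X-{z}. a x * V x z)"
        using Suc.IH z off by (intro dvd_sum) (auto simp: mult.commute[of t] intro!: mult_dvd_mono)
      ultimately show "t ^ Suc k dvd a z" by simp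
    qed
  qed auto
  show ?thesis
  proof (intro ballI, rule ccontr)
    fix x assume x: "x \<in> X" "a x \<noteq> 0"
    define k where "k = nat \<bar>a x\<bar>"
    have "t ^ k \<le> \<bar>a x\<bar>" using dvd x zdvd_imp_le[of "t ^ k" "\<bar>a x\<bar>"] by auto
    moreover have "int k < 2 ^ k" by (metis of_nat_less_two_power)
    moreover have "(2::int) ^ k \<le> t ^ k" using assms(2) by (intro power_mono) auto
    ultimately show False by (simp add: k_def)
  qed
qed

text \<open>In the equation at an index \<open>z\<close> where \<open>\<bar>c z\<bar>\<close> is
  maximal, the \<open>card D - 1\<close> remaining terms cannot balance the diagonal one unless this
  maximum is zero.\<close>

lemma zero_if_diagonally_dominant:
  fixes W :: "'b \<Rightarrow> 'b \<Rightarrow> int"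
  assumes "finite D" "0 < s"
    and diag: "\<And>y. y \<in> D \<Longrightarrow> \<bar>W y y\<bar> \<ge> int (card D) * s"
    and off: "\<And>y z. y \<in> D \<Longrightarrow> z \<in> D \<Longrightarrow> y \<noteq> z \<Longrightarrow> \<bar>W y z\<bar> \<le> s"
    and eq: "\<And>z. z \<in> D \<Longrightarrow> (\<Sum>y\<in>D. c y * W y z) = 0"
  shows "\<forall>y\<in>D. c y = 0"
proof (cases "D = {}")
  case False
  define m where "m = Max ((\<lambda>y. \<bar>c y\<bar>) ` D)"
  obtain z where z: "z \<in> D" "m = \<bar>c z\<bar>"
    using Max_in[of "(\<lambda>y. \<bar>c y\<bar>) ` D"] assms(1) False unfolding m_def by fastforce
  have le: "\<bar>c y\<bar> \<le> m" if "y \<in> D" for y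
    using assms(1) that by (auto simp: m_def)
  have "c z * W z z = - (\<Sum>y\<in>D-{z}. c y * W y z)"
    using eq[OF z(1)] z assms(1) by (simp add: sum.remove[of _ z])
  then have "m * \<bar>W z z\<bar> = \<bar>\<Sum>y\<in>D-{z}. c y * W y z\<bar>"
    by (metis abs_minus_cancel abs_mult z(2))
  also have "\<dots> \<le> (\<Sum>y\<in>D-{z}. \<bar>c y * W y z\<bar>)" by (rule sum_abs)
  also have "\<dots> \<le> (\<Sum>y\<in>D-{z}. m * s)"
    using le off z by (intro sum_mono) (auto simp: abs_mult intro!: mult_mono)
  also have "\<dots> = (int (card D) - 1) * (m * s)"
    using card.remove[OF assms(1) z(1)] by simp
  finally have "m * \<bar>W z z\<bar> \<le> (int (card D) - 1) * (m * s)" .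
  moreover have "m * \<bar>W z z\<bar> \<ge> m * (int (card D) * s)"
    using diag[OF z(1)] z by (intro mult_left_mono) auto
  ultimately have "m * s \<le> 0" by (simp add: algebra_simps)
  then have "m \<le> 0" using assms(2) by (simp add: mult_le_0_iff)
  with le show ?thesis by fastforce
qed auto

text \<open>The vectors \<open>V x\<close> are congruent to unit vectors modulo \<open>t\<close>, and the vectors \<open>w y\<close> have diagonally
  dominant principal minors; both families are independent. They are orthogonal for \<open>I - y \<notin> Y\<close>: if
  \<open>x\<close> and \<open>y\<close> agree in a coordinate outside \<open>K x\<close>, then flipping \<open>z\<close> there changes only the sign of
  \<open>V x z * w y z\<close>.\<close>

lemma reimer_butterfly:
  fixes I :: "'a set" and K :: "'a set \<Rightarrow> 'a set"
  assumes "finite I" "X \<subseteq> Pow I"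
  defines "R \<equiv> {z. \<exists>x\<in>X. z \<inter> K x = x \<inter> K x}"
    and "Y \<equiv> {z. \<exists>x\<in>X. z - K x = x - K x}"
  shows "card X \<le> card {z\<in>Pow I. z \<in> R \<and> I - z \<in> Y}"
proof -
  define n where "n = card I"
  define Q where "Q = Pow I"
  \<comment> \<open>\<open>t\<close> has to exceed 1 for the divisibility argument, even if
    \<open>n = 0\<close>, and to be at least \<open>card Q = 2 ^ n\<close> for the dominance
    argument.\<close>
  define t :: int where "t = 2 ^ (n + 1)"
  define D where "D = Q - {z\<in>Q. z \<in> R \<and> I - z \<in> Y}"
  define \<delta> where "\<delta> x z = card {j\<in>I. (j \<in> x) \<noteq> (j \<in> z)}" for x z
  define V where "V x z = (if z \<inter> K x = x \<inter> K x then t ^ \<delta> x z else 0)" for x z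
  \<comment> \<open>The Hamming distance \<open>\<delta>\<close> is at most \<open>n\<close>, so the
    exponent is never truncated. It is \<open>n + 1\<close> on the diagonal and at most
    \<open>n\<close> elsewhere. For \<open>y\<close> outside \<open>R\<close> a unit vector
    suffices, since every \<open>V x\<close> vanishes at \<open>y\<close>.\<close>
  define w where "w y z = (- 1) ^ card z * t ^ (n + 1 - \<delta> y z)" for y z :: "'a set"
  define W where "W y z = (if y \<notin> R then of_bool (y = z) else w y z)" for y z
  have Q: "finite Q" "D \<subseteq> Q" "X \<subseteq> Q" "card Q = 2 ^ n"
    using assms by (auto simp: Q_def D_def n_def card_Pow)
  have fin: "finite D" "finite X" using Q finite_subset by auto
  have t: "t > 1" unfolding t_def by (rule one_less_power) auto
  have \<delta>_eq: "\<delta> x x = 0" for x by (simp add: \<delta>_def)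
  have \<delta>_pos: "\<delta> x z > 0" if "x \<in> Q" "z \<in> Q" "x \<noteq> z" for x z
    using that assms(1) by (auto simp: \<delta>_def card_gt_0_iff Q_def)
  have \<delta>_flip: "\<delta> x z = card {j\<in>I-{i}. (j \<in> x) \<noteq> (j \<in> z)} + of_bool ((i \<in> x) \<noteq> (i \<in> z))"
    if "i \<in> I" for x z i
  proof -
    have "{j\<in>I. (j \<in> x) \<noteq> (j \<in> z)} = {j\<in>I-{i}. (j \<in> x) \<noteq> (j \<in> z)} \<union>
        (if (i \<in> x) \<noteq> (i \<in> z) then {i} else {})" using that by auto
    then show ?thesis using assms(1) by (auto simp: \<delta>_def)
  qed
  have orth_w: "(\<Sum>z\<in>Q. V x z * w y z) = 0" if x: "x \<in> X" and y: "y \<in> Q" "I - y \<notin> Y" for x y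
  proof -
    have "(I - y) - K x \<noteq> x - K x" using x y by (auto simp: Y_def)
    then obtain i where i: "i \<in> I" "i \<notin> K x" "i \<in> x \<longleftrightarrow> i \<in> y"
      using x y Q by (auto simp: Q_def)
    define f where "f z = (if i \<in> z then z - {i} else insert i z)" for z
    have f: "f (f z) = z" "f z \<in> Q \<longleftrightarrow> z \<in> Q" for z
      using i by (auto simp: f_def Q_def)
    have "V x (f z) * w y (f z) = - (V x z * w y z)" if z: "z \<in> Q" for z
    proof -
      have *: "{j\<in>I-{i}. (j \<in> u) \<noteq> (j \<in> f z)} = {j\<in>I-{i}. (j \<in> u) \<noteq> (j \<in> z)}" for u
        by (auto simp: f_def)
      have "f z \<inter> K x = x \<inter> K x \<longleftrightarrow> z \<inter> K x = x \<inter> K x" using i by (auto simp: f_def)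
      moreover have "(- 1) ^ card (f z) = - ((- 1) ^ card z :: int)"
      proof -
        have "finite z" using z assms(1) finite_subset by (auto simp: Q_def)
        have "(- 1 :: int) ^ card u = - ((- 1) ^ card (insert i u))"
          if "finite u" "i \<notin> u" for u
          using that by simp
        from this[of z] this[of "z - {i}"] \<open>finite z\<close> show ?thesis
          by (auto simp: f_def insert_absorb)
      qed
      \<comment> \<open>As \<open>x\<close> and \<open>y\<close> agree at \<open>i\<close>, the flip
        changes both distances by the same amount, and the exponents compensate;
        \<open>d y z < n\<close> makes the natural subtraction exact.\<close>
      moreover have "t ^ \<delta> x (f z) * t ^ (n + 1 - \<delta> y (f z)) = t ^ \<delta> x z * t ^ (n + 1 - \<delta> y z)"
      proof -
        define d where "d u z = card {j\<in>I-{i}. (j \<in> u) \<noteq> (j \<in> z)}" for u z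
        have \<delta>_d: "\<delta> u v = d u v + of_bool ((i \<in> u) \<noteq> (i \<in> v))" for u v
          unfolding d_def by (rule \<delta>_flip[OF i(1)])
        have "d y z \<le> card (I - {i})"
          using assms(1) unfolding d_def by (intro card_mono) auto
        moreover have "card (I - {i}) = n - 1" "n > 0"
          using i assms(1) by (auto simp: n_def card_gt_0_iff)
        ultimately have "d y z < n" by linarith
        moreover have "d u (f z) = d u z" for u unfolding d_def * ..
        ultimately have "\<delta> x (f z) + (n + 1 - \<delta> y (f z)) = \<delta> x z + (n + 1 - \<delta> y z)"
          using i(3) by (simp add: \<delta>_d of_bool_def)
        then show ?thesis by (simp only: flip: power_add)
      qed
      ultimately show ?thesis by (auto simp: V_def w_def algebra_simps)
    qed
    then have "(\<Sum>z\<in>Q. V x z * w y z) = (\<Sum>z\<in>Q. - (V x z * w y z))"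
      by (intro sum.reindex_bij_witness[of _ f f]) (auto simp: f)
    then show ?thesis by (simp add: sum_negf)
  qed
  have "card X + card D \<le> card Q"
  proof (rule card_add_le_if_orthogonal[where V = V and W = W])
    fix x y assume xy: "x \<in> X" "y \<in> D"
    show "(\<Sum>z\<in>Q. V x z * W y z) = 0"
    proof (cases "y \<in> R")
      case True
      with xy have "I - y \<notin> Y" "y \<in> Q" by (auto simp: D_def)
      with True xy show ?thesis by (simp add: W_def orth_w)
    next
      case False
      with xy have "V x y = 0" by (auto simp: V_def R_def)
      then show ?thesis using False by (auto simp: W_def intro!: sum.neutral)
    qed
  next
    fix a assume a: "\<And>z. z \<in> Q \<Longrightarrow> (\<Sum>x\<in>X. a x * V x z) = 0"
    show "\<forall>x\<in>X. a x = 0"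
    proof (rule zero_if_dvd_system[where V = V and t = t])
      fix x z assume "x \<in> X" "z \<in> X" "x \<noteq> z"
      then have "\<delta> x z > 0" using \<delta>_pos Q by blast
      then show "t dvd V x z" by (auto simp: V_def intro: dvd_power)
    qed (use a Q t fin in \<open>auto simp: V_def \<delta>_eq\<close>)
  next
    fix c assume c: "\<And>z. z \<in> Q \<Longrightarrow> (\<Sum>y\<in>D. c y * W y z) = 0"
    \<comment> \<open>At positions in \<open>R\<close> the unit vectors vanish, so only the
      \<open>w\<close> part remains and dominance applies. Afterwards the equation at a position
      \<open>y\<close> outside \<open>R\<close> reads off \<open>c y\<close>.\<close>
    have "\<forall>y\<in>D \<inter> R. c y = 0"
    proof (rule zero_if_diagonally_dominant[where W = w and s = "t ^ n"])
      have "card (D \<inter> R) \<le> 2 ^ n"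
        using Q card_mono[of Q "D \<inter> R"] by auto
      then have "int (card (D \<inter> R)) \<le> 2 ^ n"
        by (metis of_nat_le_iff of_nat_numeral of_nat_power)
      also have "(2::int) ^ n \<le> t" by (simp add: t_def)
      finally have "int (card (D \<inter> R)) \<le> t" .
      then show "int (card (D \<inter> R)) * t ^ n \<le> \<bar>w y y\<bar>" for y
        using t by (auto simp: w_def \<delta>_eq abs_mult power_abs mult_right_mono)
      show "\<bar>w y z\<bar> \<le> t ^ n" if "y \<in> D \<inter> R" "z \<in> D \<inter> R" "y \<noteq> z" for y z
      proof -
        have "\<delta> y z > 0" using that Q \<delta>_pos by blast
        then show ?thesis using t by (auto simp: w_def abs_mult power_abs intro!: power_increasing)
      qed
      show "(\<Sum>y\<in>D \<inter> R. c y * w y z) = 0" if "z \<in> D \<inter> R" for z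
      proof -
        have "(\<Sum>y\<in>D \<inter> R. c y * w y z) = (\<Sum>y\<in>D. c y * W y z)"
          using fin that by (intro sum.mono_neutral_cong_left) (auto simp: W_def)
        then show ?thesis using c[of z] that Q by auto
      qed
    qed (use fin t in auto)
    moreover have "c y = 0" if y: "y \<in> D" "y \<notin> R" for y
    proof -
      have "(\<Sum>u\<in>D. c u * W u y) = (\<Sum>u\<in>D. if u = y then c y else 0)"
        using y calculation by (intro sum.cong) (auto simp: W_def)
      then show ?thesis using c[of y] y Q fin by auto
    qed
    ultimately show "\<forall>y\<in>D. c y = 0" by auto
  qed (use Q in auto)
  moreover have "card {z\<in>Q. z \<in> R \<and> I - z \<in> Y} + card D = card Q"
    unfolding D_def using Q(1)
    by (subst card_Un_disjoint[symmetric]) (auto intro!: arg_cong[where f = card])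
  ultimately show ?thesis by (simp add: Q_def)
qed

section \<open>The inequality for measurable cylinder sets\<close>

context finite_product_prob_space
begin

text \<open>The doubled index set carries two independent points: \<open>(i, True)\<close> and
  \<open>(i, False)\<close> hold their coordinates \<open>i\<close>. The points \<open>x z\<close>
  and \<open>x (I - z)\<close> read complementary sets of indices, hence are independent, and each
  is a relabelled copy of the original product.\<close>

lemma emeasure_PiM_resample:
  fixes z :: "'a set"
  defines "x \<equiv> \<lambda>z \<omega>. \<lambda>i\<in>I. \<omega> (i, i \<in> z)"
  assumes C: "C \<in> sets (PiM I M)" and D: "D \<in> sets (PiM I M)"
  shows "emeasure (PiM (I \<times> (UNIV :: bool set)) (\<lambda>p. M (fst p)))
      {\<omega> \<in> space (PiM (I \<times> UNIV) (\<lambda>p. M (fst p))). x z \<omega> \<in> C \<and> x (I - z) \<omega> \<in> D}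
    = emeasure (PiM I M) C * emeasure (PiM I M) D"
proof -
  define N where "N = (\<lambda>p :: 'a \<times> bool. M (fst p))"
  interpret N: product_prob_space N "I \<times> UNIV"
    by (rule product_prob_spaceI) (simp add: N_def prob_space)
  define f where "f i = (i, i \<in> z)" for i
  define g where "g i = (i, i \<in> I - z)" for i
  have inj: "inj_on f I" "inj_on g I" by (auto simp: inj_on_def f_def g_def)
  have J: "f ` I \<inter> g ` I = {}" "f ` I \<union> g ` I = I \<times> UNIV" "finite (f ` I)" "finite (g ` I)"
    using finite_index by (auto simp: f_def g_def)
  have *: "{\<eta> \<in> space (PiM (h ` I) N). (\<lambda>i\<in>I. \<eta> (h i)) \<in> U} \<in> sets (PiM (h ` I) N)
      \<and> emeasure (PiM (h ` I) N) {\<eta> \<in> space (PiM (h ` I) N). (\<lambda>i\<in>I. \<eta> (h i)) \<in> U} = emeasure (PiM I M) U"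
    if h: "inj_on h I" "\<And>i. fst (h i) = i" and U: "U \<in> sets (PiM I M)" for h U
  proof -
    have "(\<lambda>\<eta>. \<lambda>i\<in>I. \<eta> (h i)) \<in> PiM (h ` I) N \<rightarrow>\<^sub>M (\<Pi>\<^sub>M i\<in>I. N (h i))"
      by (intro measurable_restrict measurable_component_singleton) auto
    moreover have M: "(\<Pi>\<^sub>M i\<in>I. N (h i)) = PiM I M"
      by (simp add: N_def h)
    ultimately have meas: "(\<lambda>\<eta>. \<lambda>i\<in>I. \<eta> (h i)) \<in> PiM (h ` I) N \<rightarrow>\<^sub>M PiM I M" by simp
    have "distr (PiM (h ` I) N) (PiM I M) (\<lambda>\<eta>. \<lambda>i\<in>I. \<eta> (h i)) = PiM I M"
      using distr_PiM_reindex[of "h ` I" N h I] h N.prob_space by (simp add: M)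
    then have "emeasure (PiM I M) U = emeasure (distr (PiM (h ` I) N) (PiM I M) (\<lambda>\<eta>. \<lambda>i\<in>I. \<eta> (h i))) U"
      by simp
    with meas U measurable_sets[OF meas U] show ?thesis
      by (simp add: emeasure_distr vimage_def Int_def conj_commute)
  qed
  define C' where "C' = {\<eta> \<in> space (PiM (f ` I) N). (\<lambda>i\<in>I. \<eta> (f i)) \<in> C}"
  define D' where "D' = {\<eta> \<in> space (PiM (g ` I) N). (\<lambda>i\<in>I. \<eta> (g i)) \<in> D}"
  have C': "C' \<in> sets (PiM (f ` I) N)" "emeasure (PiM (f ` I) N) C' = emeasure (PiM I M) C"
    using *[of f C] inj C by (auto simp: f_def C'_def)
  have D': "D' \<in> sets (PiM (g ` I) N)" "emeasure (PiM (g ` I) N) D' = emeasure (PiM I M) D"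
    using *[of g D] inj D by (auto simp: g_def D'_def)
  have meas: "(\<lambda>\<eta>. \<lambda>i\<in>I. \<eta> (h i)) \<in> PiM (I \<times> UNIV) N \<rightarrow>\<^sub>M PiM I M" if "\<And>i. fst (h i) = i" for h
  proof -
    have "h i = (i, snd (h i))" for i using that[of i] by (cases "h i") auto
    then have "(\<lambda>\<eta>. \<lambda>i\<in>I. \<eta> (h i)) \<in> PiM (I \<times> UNIV) N \<rightarrow>\<^sub>M (\<Pi>\<^sub>M i\<in>I. N (h i))"
      by (intro measurable_restrict measurable_component_singleton) (metis UNIV_I mem_Sigma_iff)
    then show ?thesis by (simp add: N_def that)
  qed
  define G where "G = {\<omega> \<in> space (PiM (I \<times> UNIV) N). x z \<omega> \<in> C \<and> x (I - z) \<omega> \<in> D}"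
  have "G = (\<lambda>\<eta>. \<lambda>i\<in>I. \<eta> (f i)) -` C \<inter> space (PiM (I \<times> UNIV) N)
      \<inter> ((\<lambda>\<eta>. \<lambda>i\<in>I. \<eta> (g i)) -` D \<inter> space (PiM (I \<times> UNIV) N))"
    by (auto simp: G_def x_def f_def g_def)
  also have "\<dots> \<in> sets (PiM (I \<times> UNIV) N)"
    using C D by (intro sets.Int measurable_sets[OF meas]) (auto simp: f_def g_def)
  finally have G: "G \<in> sets (PiM (f ` I \<union> g ` I) N)" by (simp add: J)
  interpret fI: sigma_finite_measure "PiM (f ` I) N"
    by (intro prob_space_imp_sigma_finite prob_space_PiM N.prob_space)
  interpret gI: sigma_finite_measure "PiM (g ` I) N"
    by (intro prob_space_imp_sigma_finite prob_space_PiM N.prob_space)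
  \<comment> \<open>The product measure splits along the two index sets, and \<open>G\<close>
    becomes the rectangle \<open>C' \<times> D'\<close>.\<close>
  have "emeasure (PiM (I \<times> UNIV) N) G
      = emeasure (distr (PiM (f ` I) N \<Otimes>\<^sub>M PiM (g ` I) N) (PiM (f ` I \<union> g ` I) N) (merge (f ` I) (g ` I))) G"
    by (simp only: N.distr_merge[OF J(1,3,4)]) (simp only: J(2))
  also have "\<dots> = emeasure (PiM (f ` I) N \<Otimes>\<^sub>M PiM (g ` I) N)
      (merge (f ` I) (g ` I) -` G \<inter> space (PiM (f ` I) N \<Otimes>\<^sub>M PiM (g ` I) N))"
    by (rule emeasure_distr[OF measurable_merge G])
  also have "merge (f ` I) (g ` I) -` G \<inter> space (PiM (f ` I) N \<Otimes>\<^sub>M PiM (g ` I) N) = C' \<times> D'"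
  proof -
    have "x z (merge (f ` I) (g ` I) (a, b)) = (\<lambda>i\<in>I. a (f i))"
      "x (I - z) (merge (f ` I) (g ` I) (a, b)) = (\<lambda>i\<in>I. b (g i))" for a b
      using J(1) by (auto simp: x_def merge_def f_def g_def fun_eq_iff)
    moreover have "merge (f ` I) (g ` I) (a, b) \<in> space (PiM (I \<times> UNIV) N)"
      if "a \<in> space (PiM (f ` I) N)" "b \<in> space (PiM (g ` I) N)" for a b
    proof -
      have "merge (f ` I) (g ` I) (a, b) \<in> space (PiM (f ` I \<union> g ` I) N)"
        using that unfolding space_PiM PiE_cancel_merge[OF J(1)] by auto
      then show ?thesis by (simp add: J)
    qed
    ultimately show ?thesis
      by (auto simp: G_def C'_def D'_def space_pair_measure)
  qed
  also have "emeasure (PiM (f ` I) N \<Otimes>\<^sub>M PiM (g ` I) N) (C' \<times> D')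
      = emeasure (PiM I M) C * emeasure (PiM I M) D"
    using C' D' by (simp add: gI.emeasure_pair_measure_Times)
  finally show ?thesis by (simp add: G_def N_def)
qed

text \<open>A single \<open>K\<close> encodes both disjoint witness sets: \<open>E K\<close> is
  decided by the coordinates in \<open>K\<close> and \<open>F K\<close> by those outside.
  Measurability is assumed so that the pointwise butterfly inequality can be integrated.\<close>

lemma bkr_cylinder_families:
  assumes E: "\<And>K. K \<subseteq> I \<Longrightarrow> E K \<in> sets (PiM I M)" and F: "\<And>K. K \<subseteq> I \<Longrightarrow> F K \<in> sets (PiM I M)"
    and dep_E: "\<And>K x y. \<lbrakk>K \<subseteq> I; x \<in> E K; y \<in> space (PiM I M); \<forall>i\<in>K. x i = y i\<rbrakk> \<Longrightarrow> y \<in> E K"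
    and dep_F: "\<And>K x y. \<lbrakk>K \<subseteq> I; x \<in> F K; y \<in> space (PiM I M); \<forall>i\<in>I - K. x i = y i\<rbrakk> \<Longrightarrow> y \<in> F K"
  shows "measure (PiM I M) (\<Union>K\<in>Pow I. E K \<inter> F K)
    \<le> measure (PiM I M) (\<Union>K\<in>Pow I. E K) * measure (PiM I M) (\<Union>K\<in>Pow I. F K)"
proof -
  define A where "A = (\<Union>K\<in>Pow I. E K)"
  define B where "B = (\<Union>K\<in>Pow I. F K)"
  define C where "C = (\<Union>K\<in>Pow I. E K \<inter> F K)"
  define Q where "Q = PiM (I \<times> (UNIV :: bool set)) (\<lambda>p. M (fst p))"
  define x where "x z \<omega> = (\<lambda>i\<in>I. \<omega> (i, i \<in> z))" for z and \<omega> :: "'a \<times> bool \<Rightarrow> 'b"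
  have fin: "finite (Pow I)" using finite_index by auto
  have meas: "A \<in> sets (PiM I M)" "B \<in> sets (PiM I M)" "C \<in> sets (PiM I M)"
    using fin E F unfolding A_def B_def C_def by (auto intro!: sets.finite_UN)
  have x_space: "x z \<omega> \<in> space (PiM I M)" if "\<omega> \<in> space Q" for z \<omega>
    using that by (auto simp: Q_def x_def space_PiM PiE_iff)
  have butterfly: "card {z\<in>Pow I. x z \<omega> \<in> C} \<le> card {z\<in>Pow I. x z \<omega> \<in> A \<and> x (I - z) \<omega> \<in> B}"
    if \<omega>: "\<omega> \<in> space Q" for \<omega>
  proof -
    define X where "X = {z\<in>Pow I. x z \<omega> \<in> C}"
    have "\<forall>z\<in>X. \<exists>K. K \<subseteq> I \<and> x z \<omega> \<in> E K \<and> x z \<omega> \<in> F K"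
      by (auto simp: X_def C_def)
    then obtain K where K: "\<And>z. z \<in> X \<Longrightarrow> K z \<subseteq> I \<and> x z \<omega> \<in> E (K z) \<and> x z \<omega> \<in> F (K z)"
      by metis
    \<comment> \<open>If \<open>y\<close> and \<open>z\<close> agree on \<open>K z\<close>, both
      choose the same source for these coordinates. So the set \<open>R\<close> of the butterfly
      theorem leads into \<open>A\<close>, and in the same way \<open>Y\<close> leads into
      \<open>B\<close>.\<close>
    have "x y \<omega> \<in> A" if z: "z \<in> X" "y \<inter> K z = z \<inter> K z" for y z
    proof -
      have "\<forall>i\<in>K z. x z \<omega> i = x y \<omega> i"
      proof
        fix i assume "i \<in> K z"
        with z(2) have "i \<in> z \<longleftrightarrow> i \<in> y" by blast
        then show "x z \<omega> i = x y \<omega> i" by (simp add: x_def)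
      qed
      then have "x y \<omega> \<in> E (K z)"
        using dep_E[of "K z" "x z \<omega>" "x y \<omega>"] K[OF z(1)] x_space[OF \<omega>, of y] by blast
      then show ?thesis using K[OF z(1)] by (auto simp: A_def)
    qed
    moreover have "x y \<omega> \<in> B" if z: "z \<in> X" "y - K z = z - K z" for y z
    proof -
      have "\<forall>i\<in>I - K z. x z \<omega> i = x y \<omega> i"
      proof
        fix i assume "i \<in> I - K z"
        with z(2) have "i \<in> z \<longleftrightarrow> i \<in> y" by blast
        then show "x z \<omega> i = x y \<omega> i" by (simp add: x_def)
      qed
      then have "x y \<omega> \<in> F (K z)"
        using dep_F[of "K z" "x z \<omega>" "x y \<omega>"] K[OF z(1)] x_space[OF \<omega>, of y] by blast
      then show ?thesis using K[OF z(1)] by (auto simp: B_def)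
    qed
    ultimately have "card {z\<in>Pow I. z \<in> {z. \<exists>y\<in>X. z \<inter> K y = y \<inter> K y} \<and> I - z \<in> {z. \<exists>y\<in>X. z - K y = y - K y}}
        \<le> card {z\<in>Pow I. x z \<omega> \<in> A \<and> x (I - z) \<omega> \<in> B}"
      using fin by (intro card_mono) auto
    moreover have "X \<subseteq> Pow I" by (auto simp: X_def)
    ultimately have "card X \<le> card {z\<in>Pow I. x z \<omega> \<in> A \<and> x (I - z) \<omega> \<in> B}"
      using order_trans[OF reimer_butterfly[OF finite_index, of X K]] by blast
    then show ?thesis by (simp add: X_def)
  qed
  have resample: "emeasure Q {\<omega>\<in>space Q. x z \<omega> \<in> U \<and> x (I - z) \<omega> \<in> V} = emeasure (PiM I M) U * emeasure (PiM I M) V"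
    if "U \<in> sets (PiM I M)" "V \<in> sets (PiM I M)" for U V z
    using emeasure_PiM_resample[OF that] by (simp add: Q_def x_def)
  have "x z \<in> Q \<rightarrow>\<^sub>M PiM I M" for z
  proof -
    have "x z \<in> Q \<rightarrow>\<^sub>M (\<Pi>\<^sub>M i\<in>I. (\<lambda>p. M (fst p)) (i, i \<in> z))"
      unfolding Q_def x_def
      by (intro measurable_restrict measurable_component_singleton) auto
    then show ?thesis by simp
  qed
  note [measurable] = this meas
  have single: "emeasure Q {\<omega>\<in>space Q. x z \<omega> \<in> C} = emeasure (PiM I M) C" for z
  proof -
    have "{\<omega>\<in>space Q. x z \<omega> \<in> C} = {\<omega>\<in>space Q. x z \<omega> \<in> C \<and> x (I - z) \<omega> \<in> space (PiM I M)}"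
      using x_space by auto
    then show ?thesis using resample[of C "space (PiM I M)" z] meas by (simp add: emeasure_space_1)
  qed
  \<comment> \<open>Linearity of expectation: the probabilities add up to the expected number of
    \<open>z\<close> with the property.\<close>
  have sum: "(\<Sum>z\<in>Pow I. emeasure Q {\<omega>\<in>space Q. p z \<omega>}) = (\<integral>\<^sup>+\<omega>. of_nat (card {z\<in>Pow I. p z \<omega>}) \<partial>Q)"
    if [measurable]: "\<And>z. Measurable.pred Q (p z)" for p
  proof -
    have "(\<integral>\<^sup>+\<omega>. of_nat (card {z\<in>Pow I. p z \<omega>}) \<partial>Q)
        = (\<integral>\<^sup>+\<omega>. (\<Sum>z\<in>Pow I. indicator {\<omega>\<in>space Q. p z \<omega>} \<omega>) \<partial>Q)"
    proof (rule nn_integral_cong)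
      fix \<omega> assume "\<omega> \<in> space Q"
      then have "(\<Sum>z\<in>Pow I. indicator {\<omega>\<in>space Q. p z \<omega>} \<omega>)
          = (\<Sum>z\<in>Pow I. if p z \<omega> then 1 else 0 :: ennreal)"
        by (intro sum.cong) (auto simp: indicator_def)
      also have "\<dots> = of_nat (card {z\<in>Pow I. p z \<omega>})"
        using fin by (simp add: sum.If_cases Int_def)
      finally show "of_nat (card {z\<in>Pow I. p z \<omega>}) = (\<Sum>z\<in>Pow I. indicator {\<omega>\<in>space Q. p z \<omega>} \<omega> :: ennreal)"
        by simp
    qed
    then show ?thesis by (simp add: nn_integral_sum)
  qed
  \<comment> \<open>All summands on either side are equal, because the laws do not depend on
    \<open>z\<close>; the number of subsets cancels.\<close>
  have "of_nat (card (Pow I)) * emeasure (PiM I M) C = (\<Sum>z\<in>Pow I. emeasure Q {\<omega>\<in>space Q. x z \<omega> \<in> C})"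
    by (simp add: single)
  also have "\<dots> \<le> (\<Sum>z\<in>Pow I. emeasure Q {\<omega>\<in>space Q. x z \<omega> \<in> A \<and> x (I - z) \<omega> \<in> B})"
    using butterfly by (subst (1 2) sum) (auto intro!: nn_integral_mono)
  also have "\<dots> = of_nat (card (Pow I)) * (emeasure (PiM I M) A * emeasure (PiM I M) B)"
    using meas by (simp add: resample)
  finally have "of_nat (card (Pow I)) * emeasure (PiM I M) C
    \<le> of_nat (card (Pow I)) * (emeasure (PiM I M) A * emeasure (PiM I M) B)" .
  moreover have "card (Pow I) > 0" using fin by (auto simp: card_gt_0_iff)
  ultimately have "measure (PiM I M) C \<le> measure (PiM I M) A * measure (PiM I M) B"
    by (simp add: emeasure_eq_measure ennreal_of_nat_eq_real_of_nat flip: ennreal_mult)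
  then show ?thesis by (simp add: A_def B_def C_def)
qed

end

section \<open>Souslin sets and measurable projection\<close>

text \<open>Continuity from Baire space to a discrete space. Such functions replace families indexed
  by finite sequences in Souslin schemes and are easy to reindex.\<close>

definition locally_constant :: "((nat \<Rightarrow> nat) \<Rightarrow> 'b) \<Rightarrow> bool" where
  "locally_constant f \<longleftrightarrow> (\<forall>x. \<exists>b. \<forall>y. (\<forall>i<b. y i = x i) \<longrightarrow> f y = f x)"

lemma locally_constant_const: "locally_constant (\<lambda>_. c)"
  by (simp add: locally_constant_def)

lemma locally_constant_reindex:
  assumes "locally_constant f"
  shows "locally_constant (\<lambda>z. f (\<lambda>j. z (\<rho> j)))"
  unfolding locally_constant_def
proof
  fix z
  obtain b where b: "\<And>y. (\<forall>i<b. y i = z (\<rho> i)) \<Longrightarrow> f y = f (\<lambda>j. z (\<rho> j))"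
    using assms unfolding locally_constant_def by metis
  have "\<rho> i < Suc (\<Sum>j<b. \<rho> j)" if "i < b" for i
    using member_le_sum[of i "{..<b}" \<rho>] that by simp
  then show "\<exists>b. \<forall>y. (\<forall>i<b. y i = z i) \<longrightarrow> f (\<lambda>j. y (\<rho> j)) = f (\<lambda>j. z (\<rho> j))"
    by (intro exI[of _ "Suc (\<Sum>j<b. \<rho> j)"]) (auto intro!: b)
qed

text \<open>Merges countably many functions into one whose argument names, at position
  \<open>i\<close>, the one to use. The deciding prefix must include that position, hence
  \<open>Suc i\<close> in the bound.\<close>

lemma locally_constant_select:
  assumes "\<And>n. locally_constant (g n)"
  shows "locally_constant (\<lambda>z. g (z i) z)"
  unfolding locally_constant_def
proof
  fix z
  obtain b where b: "\<And>y. (\<forall>j<b. y j = z j) \<Longrightarrow> g (z i) y = g (z i) z"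
    using assms[of "z i"] unfolding locally_constant_def by metis
  show "\<exists>b. \<forall>y. (\<forall>j<b. y j = z j) \<longrightarrow> g (y i) y = g (z i) z"
    by (intro exI[of _ "max b (Suc i)"]) (auto intro!: b)
qed

lemma open_if_locally_determined:
  fixes Z :: "(nat \<Rightarrow> nat) set"
  assumes "\<And>x. x \<in> Z \<Longrightarrow> \<exists>m. \<forall>y. (\<forall>i<m. y i = x i) \<longrightarrow> y \<in> Z"
  shows "open Z"
proof -
  obtain m where m: "\<And>x y. x \<in> Z \<Longrightarrow> \<forall>i<m x. y i = x i \<Longrightarrow> y \<in> Z"
    using assms by metis
  have "open {y :: nat \<Rightarrow> nat. \<forall>i<m. y i = x i}" for m x
  proof -
    have "{y. \<forall>i<m. y i = x i} = (\<Inter>i\<in>{..<m}. (\<lambda>y. y i) -` {x i})" by auto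
    also have "open \<dots>"
      by (intro open_INT finite_lessThan ballI open_vimage discrete_topology_class.open_discrete
          continuous_on_product_coordinates)
    finally show ?thesis .
  qed
  then have "open (\<Union>x\<in>Z. {y. \<forall>i<m x. y i = x i})" by (intro open_UN ballI)
  moreover have "(\<Union>x\<in>Z. {y. \<forall>i<m x. y i = x i}) = Z"
    using m by (intro equalityI subsetI) blast+
  ultimately show ?thesis by simp
qed

lemma compact_bounded_sequences: "compact {x :: nat \<Rightarrow> nat. \<forall>i. x i \<le> b i}"
proof -
  have "compactin (product_topology (\<lambda>i. euclidean) UNIV) (PiE UNIV (\<lambda>i. {..b i}))"
    by (simp add: compactin_PiE finite_imp_compact)
  moreover have "PiE UNIV (\<lambda>i. {..b i}) = {x. \<forall>i. x i \<le> b i}" by (auto simp: PiE_def)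
  ultimately show ?thesis by (simp add: euclidean_product_topology)
qed

text \<open>Continuity from below of the outer measure provides a bound \<open>b\<close> such that restricting finitely
  many coordinates of \<open>x\<close> by \<open>b\<close> keeps the outer measure above \<open>a\<close>; by compactness of the sequences
  bounded by \<open>b\<close>, the measurable hulls \<open>C m\<close> of the restricted unions shrink to a subset of the
  Souslin set.\<close>

lemma souslin_inner_approximation:
  fixes M :: "'a measure" and H :: "nat \<Rightarrow> (nat \<Rightarrow> nat) \<Rightarrow> 'a set"
  assumes M: "finite_measure M"
    and H: "\<And>k. locally_constant (H k)" "\<And>k x. H k x \<in> sets M"
    and a: "a < outer_measure_of M (\<Union>x. \<Inter>k. H k x)"
  shows "\<exists>V\<in>sets M. V \<subseteq> (\<Union>x. \<Inter>k. H k x) \<and> a \<le> emeasure M V"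
proof -
  interpret finite_measure M by fact
  \<comment> \<open>\<open>S 0 b\<close> is the whole Souslin set. Releasing the bound at position
    \<open>m\<close> writes \<open>S m b\<close> as an increasing union, so some finite bound there
    keeps the outer measure above \<open>a\<close>.\<close>
  define S where "S m b = {\<omega>. \<exists>x. (\<forall>i<m. x i \<le> b i) \<and> (\<forall>k. \<omega> \<in> H k x)}" for m and b :: "nat \<Rightarrow> nat"
  have S_space: "S m b \<subseteq> space M" for m b
    using sets.sets_into_space[OF H(2)] unfolding S_def by blast
  have S_cong: "S m b = S m b'" if "\<forall>i<m. b i = b' i" for m b b'
    using that by (auto simp: S_def)
  have "\<exists>f. \<forall>m. a < outer_measure_of M (S m (f m)) \<and> (\<forall>i<m. f (Suc m) i = f m i)"
  proof (rule dependent_nat_choice)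
    have "S 0 b = (\<Union>x. \<Inter>k. H k x)" for b by (auto simp: S_def)
    then show "\<exists>b. a < outer_measure_of M (S 0 b)" using a by simp
  next
    fix b m assume *: "a < outer_measure_of M (S m b)"
    have "S m b = (\<Union>j. S (Suc m) (b(m := j)))"
    proof (intro equalityI subsetI)
      fix \<omega> assume "\<omega> \<in> S m b"
      then obtain x where "\<forall>i<m. x i \<le> b i" "\<forall>k. \<omega> \<in> H k x" by (auto simp: S_def)
      then have "\<omega> \<in> S (Suc m) (b(m := x m))" by (auto simp: S_def less_Suc_eq intro!: exI[of _ x])
      then show "\<omega> \<in> (\<Union>j. S (Suc m) (b(m := j)))" by auto
    next
      fix \<omega> assume "\<omega> \<in> (\<Union>j. S (Suc m) (b(m := j)))"
      then obtain j x where x: "\<forall>i<Suc m. x i \<le> (b(m := j)) i" "\<forall>k. \<omega> \<in> H k x"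
        by (auto simp: S_def)
      have "x i \<le> b i" if "i < m" for i using x(1)[rule_format, of i] that by simp
      with x(2) show "\<omega> \<in> S m b" by (auto simp: S_def)
    qed
    moreover have "incseq (\<lambda>j. S (Suc m) (b(m := j)))"
      unfolding incseq_def S_def by (auto intro: order_trans)
    ultimately have "outer_measure_of M (S m b) = (SUP j. outer_measure_of M (S (Suc m) (b(m := j))))"
      using S_space by (simp add: SUP_outer_measure_of_incseq)
    with * obtain j where "a < outer_measure_of M (S (Suc m) (b(m := j)))"
      by (auto simp: less_SUP_iff)
    then show "\<exists>c. a < outer_measure_of M (S (Suc m) c) \<and> (\<forall>i<m. c i = b i)"
      by (intro exI[of _ "b(m := j)"]) auto
  qed
  then obtain f where "\<forall>m. a < outer_measure_of M (S m (f m)) \<and> (\<forall>i<m. f (Suc m) i = f m i)" ..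
  then have f: "a < outer_measure_of M (S m (f m))" "i < m \<Longrightarrow> f (Suc m) i = f m i" for m i
    by blast+
  \<comment> \<open>Diagonal choice: entry \<open>i\<close> never changes from stage
    \<open>Suc i\<close> on.\<close>
  define b where "b i = f (Suc i) i" for i
  have "f m i = b i" if "i < m" for i m
    using that by (induction m) (auto simp: less_Suc_eq b_def f(2))
  then have a_less: "a < outer_measure_of M (S m b)" for m
    using f(1)[of m] S_cong[of m b "f m"] by auto
  \<comment> \<open>\<open>const k m x\<close> says that the first \<open>m\<close> entries of
    \<open>x\<close> decide \<open>H k\<close>. \<open>G m x\<close> imposes only the conditions
    below \<open>m\<close> that are already decided, so it depends on this prefix alone; hence
    \<open>C m\<close> is a finite union of measurable sets.\<close>
  define const where "const k m x \<longleftrightarrow> (\<forall>y. (\<forall>i<m. y i = x i) \<longrightarrow> H k y = H k x)" for k m and x :: "nat \<Rightarrow> nat"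
  define G where "G m x = {\<omega>\<in>space M. \<forall>k<m. const k m x \<longrightarrow> \<omega> \<in> H k x}" for m x
  define C where "C m = (\<Union>x\<in>{x. \<forall>i<m. x i \<le> b i}. G m x)" for m
  have const_mono: "const k n x" if "const k m x" "m \<le> n" for k m n x
    using that unfolding const_def by (meson less_le_trans)
  have G_cong: "G m x = G m y" if "\<forall>i<m. y i = x i" for m x y
  proof -
    have const: "const k m y \<and> H k y = H k x" if "const k m x" "\<forall>i<m. y i = x i" for k and x y
    proof -
      have x_eq: "H k u = H k x" if "\<forall>i<m. u i = y i" for u
      proof -
        have "\<forall>i<m. u i = x i" using that \<open>\<forall>i<m. y i = x i\<close> by simp
        then show ?thesis using \<open>const k m x\<close> unfolding const_def by blast
      qed
      from x_eq[of y] x_eq show ?thesis unfolding const_def by metis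
    qed
    have "const k m x \<longleftrightarrow> const k m y" for k
      using const[of k x y] const[of k y x] that by auto
    moreover have "H k y = H k x" if "const k m x" for k
      using const[of k x y] that \<open>\<forall>i<m. y i = x i\<close> by blast
    ultimately show ?thesis by (auto simp: G_def)
  qed
  have C_sets: "C m \<in> sets M" for m
  proof -
    define e where "e f i = (if i < m then f i else 0)" for f :: "nat \<Rightarrow> nat" and i
    have "C m = (\<Union>f\<in>PiE {..<m} (\<lambda>i. {..b i}). G m (e f))"
    proof (intro equalityI subsetI)
      fix \<omega> assume "\<omega> \<in> C m"
      then obtain x where x: "\<forall>i<m. x i \<le> b i" "\<omega> \<in> G m x" by (auto simp: C_def)
      have "G m x = G m (e (restrict x {..<m}))" by (rule G_cong) (auto simp: e_def)
      moreover have "restrict x {..<m} \<in> PiE {..<m} (\<lambda>i. {..b i})" using x by auto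
      ultimately show "\<omega> \<in> (\<Union>f\<in>PiE {..<m} (\<lambda>i. {..b i}). G m (e f))" using x by blast
    next
      fix \<omega> assume "\<omega> \<in> (\<Union>f\<in>PiE {..<m} (\<lambda>i. {..b i}). G m (e f))"
      then obtain f where f: "f \<in> PiE {..<m} (\<lambda>i. {..b i})" "\<omega> \<in> G m (e f)" by blast
      have "\<forall>i<m. e f i \<le> b i" using f(1) by (auto simp: e_def PiE_iff)
      with f(2) show "\<omega> \<in> C m" unfolding C_def by blast
    qed
    moreover have "G m x \<in> sets M" for x
      unfolding G_def using H(2) by measurable
    ultimately show ?thesis by (auto intro!: sets.finite_UN finite_PiE)
  qed
  have C_decseq: "decseq C"
    unfolding decseq_Suc_iff
  proof
    fix m
    have "G (Suc m) x \<subseteq> G m x" for x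
      using const_mono[of _ m x "Suc m"] by (auto simp: G_def)
    then show "C (Suc m) \<subseteq> C m" unfolding C_def by (intro UN_mono) auto
  qed
  have S_C: "S m b \<subseteq> C m" for m
  proof
    fix \<omega> assume \<omega>: "\<omega> \<in> S m b"
    then obtain x where x: "\<forall>i<m. x i \<le> b i" "\<forall>k. \<omega> \<in> H k x" by (auto simp: S_def)
    then have "\<omega> \<in> G m x" using S_space[of m b] \<omega> by (auto simp: G_def)
    with x(1) show "\<omega> \<in> C m" unfolding C_def by blast
  qed
  have a_le: "a \<le> emeasure M (C m)" for m
    using less_le_trans[OF a_less outer_measure_of_mono[OF S_C[of m]]] C_sets[of m] by simp
  have "(\<Inter>m. C m) \<subseteq> (\<Union>x. \<Inter>k. H k x)"
  proof
    fix \<omega> assume \<omega>: "\<omega> \<in> (\<Inter>m. C m)"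
    have "{x. \<forall>i. x i \<le> b i} \<inter> (\<Inter>m\<in>UNIV. {x. \<omega> \<in> G m x}) \<noteq> {}"
    proof (rule compact_imp_fip_image[OF compact_bounded_sequences])
      fix m show "closed {x. \<omega> \<in> G m x}"
        unfolding closed_def
        proof (rule open_if_locally_determined, intro exI allI impI)
        fix x y assume "x \<in> - {x. \<omega> \<in> G m x}" "\<forall>i<m. y i = x i"
        then show "y \<in> - {x. \<omega> \<in> G m x}" using G_cong[of m y x] by simp
      qed
    next
      fix F :: "nat set" assume "finite F"
      then obtain n where n: "\<forall>m\<in>F. m \<le> n" using finite_nat_set_iff_bounded_le by auto
      obtain x where x: "\<forall>i<n. x i \<le> b i" "\<omega> \<in> G n x" using \<omega> by (auto simp: C_def)
      \<comment> \<open>The zero tail makes \<open>y\<close> obey all bounds while keeping the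
        prefix that \<open>G n\<close> looks at.\<close>
      define y where "y i = (if i < n then x i else 0)" for i
      have "\<omega> \<in> G n y" using x G_cong[of n y x] by (auto simp: y_def)
      moreover have "G n y \<subseteq> G m y" if "m \<le> n" for m
        using const_mono[OF _ that] that by (auto simp: G_def)
      ultimately have "y \<in> {x. \<forall>i. x i \<le> b i} \<inter> (\<Inter>m\<in>F. {x. \<omega> \<in> G m x})"
        using n x by (auto simp: y_def)
      then show "{x. \<forall>i. x i \<le> b i} \<inter> (\<Inter>m\<in>F. {x. \<omega> \<in> G m x}) \<noteq> {}" by blast
    qed
    then obtain x where x: "\<And>m. \<omega> \<in> G m x" by auto
    have "\<omega> \<in> H k x" for k
    proof -
      obtain m where "const k m x" using H(1)[of k] unfolding locally_constant_def const_def by blast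
      \<comment> \<open>At this index condition \<open>k\<close> is both decided and among those
        that \<open>G\<close> imposes.\<close>
      then have "const k (max m (Suc k)) x" by (rule const_mono) simp
      then show ?thesis using x[of "max m (Suc k)"] by (auto simp: G_def)
    qed
    then show "\<omega> \<in> (\<Union>x. \<Inter>k. H k x)" by auto
  qed
  moreover have "a \<le> emeasure M (\<Inter>m. C m)"
    using a_le C_sets C_decseq
    by (subst INF_emeasure_decseq[symmetric]) (auto intro!: INF_greatest)
  moreover have "(\<Inter>m. C m) \<in> sets M" using C_sets by auto
  ultimately show ?thesis by blast
qed

text \<open>The set lies between a measurable hull \<open>U\<close> and a countable union
  \<open>W\<close> of inner approximations of the same measure, so it differs from \<open>W\<close>
  by a subset of a null set.\<close>

lemma souslin_in_completion:
  fixes M :: "'a measure" and H :: "nat \<Rightarrow> (nat \<Rightarrow> nat) \<Rightarrow> 'a set"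
  assumes M: "finite_measure M"
    and H: "\<And>k. locally_constant (H k)" "\<And>k x. H k x \<in> sets M"
  shows "(\<Union>x. \<Inter>k. H k x) \<in> sets (completion M)"
proof -
  interpret finite_measure M by fact
  define S where "S = (\<Union>x. \<Inter>k. H k x)"
  have "S \<subseteq> space M" using sets.sets_into_space[OF H(2)] unfolding S_def by blast
  then obtain U where U: "U \<in> sets M" "S \<subseteq> U" "outer_measure_of M S = emeasure M U"
    using outer_measure_of_attain by metis
  \<comment> \<open>\<open>ennreal\<close> sends negative numbers to 0, so the bound is strictly
    below the outer measure only if the latter is positive; otherwise the empty set serves.\<close>
  have "\<exists>V\<in>sets M. V \<subseteq> S \<and> measure M U - 1 / Suc n \<le> measure M V" for n
  proof (cases "measure M U = 0")
    case False
    then have pos: "measure M U > 0" by (simp add: zero_less_measure_iff)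
    then have "ennreal (measure M U - 1 / Suc n) < emeasure M U"
      by (auto simp: emeasure_eq_measure ennreal_less_iff intro!: ennreal_lessI)
    then obtain V where "V \<in> sets M" "V \<subseteq> S" "ennreal (measure M U - 1 / Suc n) \<le> emeasure M V"
      using souslin_inner_approximation[OF M, of H,  OF H, of "ennreal (measure M U - 1 / Suc n)"] U(3)
      unfolding S_def by metis
    then show ?thesis by (auto simp: emeasure_eq_measure ennreal_le_iff)
  qed auto
  then obtain V where V: "\<And>n. V n \<in> sets M" "\<And>n. V n \<subseteq> S"
    "\<And>n. measure M U - 1 / Suc n \<le> measure M (V n)" by metis
  define W where "W = (\<Union>n. V n)"
  have W: "W \<in> sets M" "W \<subseteq> S" using V by (auto simp: W_def)
  have "measure M U \<le> measure M W"
  proof (rule LIMSEQ_le_const2)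
    show "(\<lambda>n. measure M U - 1 / Suc n) \<longlonglongrightarrow> measure M U"
      using tendsto_diff[OF tendsto_const LIMSEQ_inverse_real_of_nat] by (simp add: inverse_eq_divide)
    have "measure M (V n) \<le> measure M W" for n
      using V W by (intro finite_measure_mono) (auto simp: W_def)
    then show "\<exists>N. \<forall>n\<ge>N. measure M U - 1 / Suc n \<le> measure M W"
      using V(3) order_trans by blast
  qed
  then have "measure M (U - W) = 0"
    using U W measure_nonneg[of M "U - W"] by (simp add: finite_measure_Diff)
  then have "U - W \<in> null_sets M" using U W by (auto simp: null_sets_def emeasure_eq_measure)
  then have "W \<union> (S - W) \<in> sets (completion M)"
    using W U by (intro sets_completionI[of _ W "S - W" "U - W"]) auto
  then show ?thesis using W by (simp add: S_def Un_absorb1 Un_Diff_cancel)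
qed

section \<open>Souslin sets with a parameter, and projections\<close>

abbreviation baire_space :: "(nat \<Rightarrow> nat) measure" where
  "baire_space \<equiv> PiM UNIV (\<lambda>_. count_space UNIV)"

text \<open>The standard identification of pairs of sequences with single sequences.\<close>

definition interleave :: "(nat \<Rightarrow> nat) \<Rightarrow> (nat \<Rightarrow> nat) \<Rightarrow> nat \<Rightarrow> nat" where
  "interleave x u j = (if even j then x (j div 2) else u (j div 2))"

text \<open>The auxiliary sequence \<open>u\<close> makes the class of such sets closed under countable unions and
  intersections, while a projection merely absorbs \<open>x\<close> into \<open>u\<close>.\<close>

definition souslin_scheme ::
  "'a measure \<Rightarrow> (nat \<Rightarrow> (nat \<Rightarrow> nat) \<Rightarrow> 'a set) \<Rightarrow> ('a \<times> (nat \<Rightarrow> nat)) set \<Rightarrow> bool" where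
  "souslin_scheme M H E \<longleftrightarrow> (\<forall>k. locally_constant (H k)) \<and> (\<forall>k z. H k z \<in> sets M) \<and>
     E = {(\<omega>, x). \<exists>u. \<forall>k. \<omega> \<in> H k (interleave x u)}"

definition souslin_graph :: "'a measure \<Rightarrow> ('a \<times> (nat \<Rightarrow> nat)) set \<Rightarrow> bool" where
  "souslin_graph M E \<longleftrightarrow> (\<exists>H. souslin_scheme M H E)"

text \<open>The entry \<open>u 0\<close> stores the index \<open>n\<close> of the set, and the rest
  of \<open>u\<close> is the witness for \<open>E n\<close>.\<close>

lemma souslin_graph_UN:
  assumes "\<And>n::nat. souslin_graph M (E n)"
  shows "souslin_graph M (\<Union>n. E n)"
proof -
  obtain H where "\<And>n. souslin_scheme M (H n) (E n)"
    using assms unfolding souslin_graph_def by metis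
  then have H: "locally_constant (H n k)" "H n k z \<in> sets M"
    "E n = {(\<omega>, x). \<exists>u. \<forall>k::nat. \<omega> \<in> H n k (interleave x u)}" for n k z
    by (simp_all add: souslin_scheme_def)
  \<comment> \<open>Position 1 of the interleaved sequence holds \<open>u 0\<close>; shifting odd
    positions by 2 skips it.\<close>
  define \<rho> where "\<rho> j = (if even j then j else j + 2)" for j :: nat
  define H' where "H' k z = H (z 1) k (\<lambda>j. z (\<rho> j))" for k z
  have reindex: "(\<lambda>j. interleave x u (\<rho> j)) = interleave x (\<lambda>i. u (Suc i))" for x u
    by (auto simp: interleave_def \<rho>_def fun_eq_iff)
  have H': "H' k (interleave x u) = H (u 0) k (interleave x (\<lambda>i. u (Suc i)))" for k x u
    by (simp add: H'_def reindex) (simp add: interleave_def)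
  have iff: "(\<exists>u. \<forall>k. \<omega> \<in> H' k (interleave x u)) \<longleftrightarrow> (\<exists>n u. \<forall>k. \<omega> \<in> H n k (interleave x u))" for \<omega> x
  proof
    assume "\<exists>n u. \<forall>k. \<omega> \<in> H n k (interleave x u)"
    then obtain n u where "\<forall>k. \<omega> \<in> H n k (interleave x u)" by blast
    then show "\<exists>u. \<forall>k. \<omega> \<in> H' k (interleave x u)"
      by (intro exI[of _ "case_nat n u"]) (simp add: H')
  qed (auto simp: H')
  have "(\<Union>n. E n) = {(\<omega>, x). \<exists>u. \<forall>k. \<omega> \<in> H' k (interleave x u)}"
    by (simp add: H(3) set_eq_iff iff)
  moreover have "locally_constant (H' k)" for k
    unfolding H'_def[abs_def] using locally_constant_reindex[OF H(1)]
    by (intro locally_constant_select[of "\<lambda>n z. H n k (\<lambda>j. z (\<rho> j))"])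
  moreover have "H' k z \<in> sets M" for k z
    using H(2) by (simp add: H'_def)
  ultimately have "souslin_scheme M H' (\<Union>n. E n)" by (simp add: souslin_scheme_def)
  then show ?thesis unfolding souslin_graph_def by blast
qed

text \<open>One sequence holds witnesses for all \<open>n\<close> at once, split by the pairing
  function; pairing also enumerates the conditions \<open>(n, k)\<close> by a single index.\<close>

lemma souslin_graph_INT:
  assumes "\<And>n::nat. souslin_graph M (E n)"
  shows "souslin_graph M (\<Inter>n. E n)"
proof -
  obtain H where "\<And>n. souslin_scheme M (H n) (E n)"
    using assms unfolding souslin_graph_def by metis
  then have H: "locally_constant (H n k)" "H n k z \<in> sets M"
    "E n = {(\<omega>, x). \<exists>u. \<forall>k::nat. \<omega> \<in> H n k (interleave x u)}" for n k z
    by (simp_all add: souslin_scheme_def)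
  define \<rho> where "\<rho> n j = (if even j then j else 2 * prod_encode (n, j div 2) + 1)" for n j :: nat
  define H' where "H' m z = (case prod_decode m of (n, k) \<Rightarrow> H n k (\<lambda>j. z (\<rho> n j)))" for m z
  have reindex: "(\<lambda>j. interleave x u (\<rho> n j)) = interleave x (\<lambda>i. u (prod_encode (n, i)))" for x u n
    by (auto simp: interleave_def \<rho>_def fun_eq_iff)
  have H': "(\<forall>m. \<omega> \<in> H' m (interleave x u))
      \<longleftrightarrow> (\<forall>n k. \<omega> \<in> H n k (interleave x (\<lambda>i. u (prod_encode (n, i)))))" for \<omega> x u
    by (simp add: H'_def reindex split: prod.split) (metis prod_encode_inverse)
  have iff: "(\<exists>u. \<forall>m. \<omega> \<in> H' m (interleave x u)) \<longleftrightarrow> (\<forall>n. \<exists>u. \<forall>k. \<omega> \<in> H n k (interleave x u))" for \<omega> x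
  proof
    assume "\<forall>n. \<exists>u. \<forall>k. \<omega> \<in> H n k (interleave x u)"
    then obtain u where "\<forall>n k. \<omega> \<in> H n k (interleave x (u n))" by metis
    then show "\<exists>u. \<forall>m. \<omega> \<in> H' m (interleave x u)"
      unfolding H' by (intro exI[of _ "\<lambda>p. case prod_decode p of (n, i) \<Rightarrow> u n i"]) simp
  qed (use H' in blast)
  have "(\<Inter>n. E n) = {(\<omega>, x). \<exists>u. \<forall>m. \<omega> \<in> H' m (interleave x u)}"
    by (simp add: H(3) set_eq_iff iff)
  moreover have "locally_constant (H' m)" for m
    unfolding H'_def[abs_def] by (cases "prod_decode m") (simp add: locally_constant_reindex H(1))
  moreover have "H' k z \<in> sets M" for k z
    using H(2) by (simp add: H'_def split: prod.split)
  ultimately have "souslin_scheme M H' (\<Inter>n. E n)" by (simp add: souslin_scheme_def)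
  then show ?thesis unfolding souslin_graph_def by blast
qed

lemma souslin_graph_Times_UNIV:
  assumes "A \<in> sets M" shows "souslin_graph M (A \<times> UNIV)"
  unfolding souslin_graph_def souslin_scheme_def
  using assms by (intro exI[of _ "\<lambda>_ _. A"]) (auto simp: locally_constant_const)

lemma souslin_graph_coordinate: "souslin_graph M (space M \<times> {x. x i \<in> B})"
proof -
  define H where "H (k::nat) z = (if z (2 * i) \<in> B then space M else {})" for k and z :: "nat \<Rightarrow> nat"
  have "locally_constant (H k)" for k
    using locally_constant_select[of "\<lambda>n _. if n \<in> B then space M else {}" "2 * i"]
    by (simp add: H_def[abs_def] locally_constant_const)
  moreover have "space M \<times> {x. x i \<in> B} = {(\<omega>, x). \<exists>u. \<forall>k. \<omega> \<in> H k (interleave x u)}"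
    by (auto simp: H_def interleave_def split: if_splits)
  moreover have "H k z \<in> sets M" for k z by (simp add: H_def)
  ultimately have "souslin_scheme M H (space M \<times> {x. x i \<in> B})" by (simp add: souslin_scheme_def)
  then show ?thesis unfolding souslin_graph_def by blast
qed

text \<open>The sets that are Souslin together with their complement form a sigma algebra, by De
  Morgan and closure under countable unions and intersections. Both projections are measurable for
  it, so it contains the product sigma algebra.\<close>

lemma souslin_graph_if_measurable:
  fixes M :: "'a measure"
  assumes E: "E \<in> sets (M \<Otimes>\<^sub>M baire_space)"
  shows "souslin_graph M E"
proof -
  define \<Omega> where "\<Omega> = space M \<times> (UNIV :: (nat \<Rightarrow> nat) set)"
  define \<C> where "\<C> = {E. E \<subseteq> \<Omega> \<and> souslin_graph M E \<and> souslin_graph M (\<Omega> - E)}"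
  have Diff: "\<Omega> - A \<in> \<C>" if "A \<in> \<C>" for A
    using that by (auto simp: \<C>_def double_diff)
  have \<Omega>_sg: "souslin_graph M \<Omega>" "souslin_graph M {}"
    using souslin_graph_Times_UNIV[of "space M" M] souslin_graph_Times_UNIV[of "{}" M]
    by (auto simp: \<Omega>_def)
  have "sigma_algebra \<Omega> \<C>"
    unfolding sigma_algebra_iff2
  proof (intro conjI ballI allI impI)
    fix A :: "nat \<Rightarrow> _" assume A: "range A \<subseteq> \<C>"
    have "\<Omega> - (\<Union>n. A n) = (\<Inter>n. \<Omega> - A n)" by auto
    then show "(\<Union>n. A n) \<in> \<C>"
      using A souslin_graph_UN[of M A] souslin_graph_INT[of M "\<lambda>n. \<Omega> - A n"]
      by (auto simp: \<C>_def image_subset_iff)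
  qed (use Diff \<Omega>_sg in \<open>auto simp: \<C>_def\<close>)
  then interpret C: sigma_algebra \<Omega> \<C> .
  define M0 where "M0 = measure_of \<Omega> \<C> (\<lambda>_. 0)"
  have M0: "space M0 = \<Omega>" "sets M0 = \<C>"
    using C.space_closed by (auto simp: M0_def C.sets_measure_of_eq)
  have "fst \<in> M0 \<rightarrow>\<^sub>M M"
  proof (rule measurableI)
    fix A assume A: "A \<in> sets M"
    have "A \<subseteq> space M" using A by (rule sets.sets_into_space)
    then have "fst -` A \<inter> space M0 = A \<times> UNIV" "\<Omega> - A \<times> UNIV = (space M - A) \<times> UNIV"
      by (auto simp: M0 \<Omega>_def)
    then show "fst -` A \<inter> space M0 \<in> sets M0"
      using A souslin_graph_Times_UNIV[OF A] souslin_graph_Times_UNIV[of "space M - A" M] \<open>A \<subseteq> space M\<close>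
      unfolding M0 \<C>_def by (auto simp: \<Omega>_def)
  qed (auto simp: M0 \<Omega>_def)
  moreover have "snd \<in> M0 \<rightarrow>\<^sub>M baire_space"
  proof (rule measurable_PiM_single')
    fix i :: nat
    show "(\<lambda>p. snd p i) \<in> M0 \<rightarrow>\<^sub>M count_space UNIV"
    proof (rule measurableI)
      fix B :: "nat set"
      have "(\<lambda>p. snd p i) -` B \<inter> space M0 = space M \<times> {x. x i \<in> B}"
        "\<Omega> - space M \<times> {x. x i \<in> B} = space M \<times> {x. x i \<in> - B}"
        by (auto simp: M0 \<Omega>_def)
      then show "(\<lambda>p. snd p i) -` B \<inter> space M0 \<in> sets M0"
        using souslin_graph_coordinate[of M i B] souslin_graph_coordinate[of M i "- B"]
        unfolding M0 \<C>_def by (auto simp: \<Omega>_def)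
    qed auto
  qed (auto simp: PiE_def)
  ultimately have "(\<lambda>p. (fst p, snd p)) \<in> M0 \<rightarrow>\<^sub>M M \<Otimes>\<^sub>M baire_space"
    by (rule measurable_Pair)
  from measurable_sets[OF this E] have "E \<inter> \<Omega> \<in> \<C>"
    by (simp add: M0 vimage_def)
  moreover have "E \<subseteq> \<Omega>"
    using sets.sets_into_space[OF E] by (auto simp: \<Omega>_def space_pair_measure)
  ultimately show ?thesis by (simp add: \<C>_def Int_absorb2)
qed

theorem measurable_projection:
  fixes M :: "'a measure"
  assumes "finite_measure M"
    and "E \<in> sets (M \<Otimes>\<^sub>M baire_space)"
  shows "fst ` E \<in> sets (completion M)"
proof -
  obtain H where "souslin_scheme M H E"
    using souslin_graph_if_measurable[OF assms(2)] unfolding souslin_graph_def ..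
  then have H: "locally_constant (H k)" "H k z \<in> sets M"
    "E = {(\<omega>, x). \<exists>u. \<forall>k. \<omega> \<in> H k (interleave x u)}" for k z
    by (simp_all add: souslin_scheme_def)
  \<comment> \<open>Every sequence arises by interleaving, so the quantifiers over \<open>x\<close>
    and \<open>u\<close> merge into one over \<open>z\<close>.\<close>
  have "interleave (\<lambda>i. z (2 * i)) (\<lambda>i. z (2 * i + 1)) = z" for z
    by (auto simp: interleave_def fun_eq_iff elim: oddE)
  then have "(\<exists>x u. \<forall>k. \<omega> \<in> H k (interleave x u)) \<longleftrightarrow> (\<exists>z. \<forall>k. \<omega> \<in> H k z)" for \<omega>
    by metis
  then have "fst ` E = (\<Union>z. \<Inter>k. H k z)"
    by (force simp: H(3) image_iff)
  then show ?thesis using souslin_in_completion[of M H, OF assms(1) H(1,2)] by simp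
qed

section \<open>Polish spaces as images of Baire space\<close>

lemma sets_baire_space: "sets baire_space = sets borel"
proof -
  have "sets baire_space = sets (PiM (UNIV :: nat set) (\<lambda>_. borel :: nat measure))"
    by (intro sets_PiM_cong) (simp_all add: sets_borel_eq_count_space)
  then show ?thesis by (simp add: sets_PiM_equal_borel)
qed

lemma space_borel_of: "space (borel_of X) = topspace X"
  unfolding borel_of_def by (rule space_measure_of) (auto dest: openin_subset)

text \<open>A sequence of dense points is followed only where this keeps the sequence Cauchy, so that every
  element of Baire space encodes a point.\<close>

lemma polish_topology_image_baire_space:
  assumes X: "polish_topology X" "topspace X \<noteq> {}"
  shows "\<exists>\<phi>\<in>baire_space \<rightarrow>\<^sub>M borel_of X. range \<phi> = topspace X"
proof -
  obtain M d where "Metric_space M d" and complete: "Metric_space.mcomplete M d"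
    and X_eq: "X = Metric_space.mtopology M d"
    using X unfolding polish_topology_def completely_metrizable_space_def by blast
  interpret Metric_space M d by fact
  obtain C where C: "countable C" "C \<subseteq> M" "mtopology closure_of C = M"
    using X unfolding polish_topology_def separable_space_def X_eq by auto
  have "C \<noteq> {}" using C X by (auto simp: X_eq)
  define e where "e = from_nat_into C"
  have e: "e n \<in> M" for n
    using from_nat_into[OF \<open>C \<noteq> {}\<close>] C by (auto simp: e_def)
  have dense: "\<exists>n. d t (e n) < r" if "t \<in> M" "r > 0" for t r
  proof -
    have "t \<in> mtopology closure_of C" using C that by simp
    then have "\<exists>c\<in>C. d t c < r" using that unfolding metric_closure_of in_mball by blast
    then obtain c where "c \<in> C" "d t c < r" by blast
    moreover obtain n where "c = e n"
      using from_nat_into_surj[OF C(1) \<open>c \<in> C\<close>] by (auto simp: e_def)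
    ultimately show ?thesis by auto
  qed
  \<comment> \<open>A move of length at least \<open>(1/2) ^ k\<close> is refused and the current
    point kept. The \<open>k\<close>-th point depends on the first \<open>Suc k\<close> entries
    only, which makes the limit continuous in \<open>x\<close>.\<close>
  define y where "y x = rec_nat (e (x 0))
    (\<lambda>k p. if d p (e (x (Suc k))) < (1/2) ^ k then e (x (Suc k)) else p)" for x :: "nat \<Rightarrow> nat"
  have y_0: "y x 0 = e (x 0)" for x by (simp add: y_def)
  have y_Suc: "y x (Suc k) = (if d (y x k) (e (x (Suc k))) < (1/2) ^ k then e (x (Suc k)) else y x k)" for x k
    by (simp add: y_def)
  have y_M: "y x k \<in> M" for x k by (induction k) (simp_all add: y_0 y_Suc e)
  have y_cong: "y x k = y x' k" if "\<forall>i<Suc k. x i = x' i" for x x' k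
    using that by (induction k) (simp_all add: y_0 y_Suc)
  have step: "d (y x k) (y x (Suc k)) \<le> (1/2) ^ k" for x k
    using y_M by (simp add: y_Suc)
  have tail: "d (y x k) (y x (k + m)) \<le> 2 * (1/2) ^ k - 2 * (1/2) ^ (k + m)" for x k m
  proof (induction m)
    case (Suc m)
    have "d (y x k) (y x (k + Suc m)) \<le> d (y x k) (y x (k + m)) + d (y x (k + m)) (y x (Suc (k + m)))"
      using y_M by (simp add: triangle)
    then show ?case using Suc step[of x "k + m"] by simp
  qed (use y_M in simp)
  have tail_le: "d (y x k) (y x n) \<le> 2 * (1/2) ^ k" if "k \<le> n" for x k n
  proof -
    have "d (y x k) (y x (k + (n - k))) \<le> 2 * (1/2) ^ k - 2 * (1/2) ^ (k + (n - k))" by (rule tail)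
    also have "\<dots> \<le> 2 * (1/2) ^ k" by simp
    finally show ?thesis using that by simp
  qed
  \<comment> \<open>The factor 4 covers two tails of size \<open>2 * (1/2) ^ k\<close> each.\<close>
  have small: "\<exists>k. 4 * (1/2) ^ k < r" if "r > 0" for r :: real
    using real_arch_pow_inv[of "r / 4" "1/2"] that by (simp add: less_divide_eq mult.commute)
  have "MCauchy (y x)" for x
    unfolding MCauchy_def
  proof (intro conjI allI impI)
    fix r :: real assume "r > 0"
    then obtain k where k: "4 * (1/2) ^ k < r" using small by blast
    have "d (y x n) (y x n') < r" if "k \<le> n" "k \<le> n'" for n n'
    proof -
      have "d (y x n) (y x n') \<le> d (y x n) (y x k) + d (y x k) (y x n')"
        using y_M by (simp add: triangle)
      also have "\<dots> \<le> 2 * (1/2) ^ k + 2 * (1/2) ^ k"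
        using tail_le[OF that(1), of x] tail_le[OF that(2), of x] by (simp add: commute)
      finally show ?thesis using k by simp
    qed
    then show "\<exists>N. \<forall>n n'. N \<le> n \<longrightarrow> N \<le> n' \<longrightarrow> d (y x n) (y x n') < r" by blast
  qed (use y_M in auto)
  then have "\<forall>x. \<exists>l. limitin mtopology (y x) l sequentially"
    using complete by (simp add: mcomplete_def)
  from choice[OF this] obtain \<phi> where \<phi>: "\<And>x. limitin mtopology (y x) (\<phi> x) sequentially"
    by blast
  have \<phi>_M: "\<phi> x \<in> M" for x using limitin_topspace[OF \<phi>[of x]] by simp
  have \<phi>_dist: "d (y x k) (\<phi> x) \<le> 2 * (1/2) ^ k" for x k
  proof (rule field_le_epsilon)
    fix r :: real assume "r > 0"
    then have "\<forall>\<^sub>F n in sequentially. y x n \<in> M \<and> d (y x n) (\<phi> x) < r"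
      using \<phi>[of x] by (simp add: limitin_metric)
    then obtain N where N: "\<And>n. n \<ge> N \<Longrightarrow> d (y x n) (\<phi> x) < r"
      by (auto simp: eventually_sequentially)
    have "d (y x k) (\<phi> x) \<le> d (y x k) (y x (max N k)) + d (y x (max N k)) (\<phi> x)"
      using y_M \<phi>_M by (simp add: triangle)
    then show "d (y x k) (\<phi> x) \<le> 2 * (1/2) ^ k + r"
      using tail_le[of k "max N k" x] N[of "max N k"] by simp
  qed
  have "open (\<phi> -` U)" if U: "openin mtopology U" for U
  proof (rule open_if_locally_determined)
    fix x assume "x \<in> \<phi> -` U"
    then obtain r where r: "r > 0" "mball (\<phi> x) r \<subseteq> U"
      using U by (auto simp: openin_mtopology)
    obtain k where k: "4 * (1/2) ^ k < r" using small[OF r(1)] by blast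
    have "x' \<in> \<phi> -` U" if "\<forall>i<Suc k. x' i = x i" for x'
    proof -
      have "d (\<phi> x) (\<phi> x') \<le> d (\<phi> x) (y x k) + d (y x k) (\<phi> x')"
        using y_M \<phi>_M by (simp add: triangle)
      also have "\<dots> \<le> 2 * (1/2) ^ k + 2 * (1/2) ^ k"
        using \<phi>_dist[of x k] \<phi>_dist[of x' k] y_cong[OF that] by (simp add: commute)
      finally have "\<phi> x' \<in> mball (\<phi> x) r" using k \<phi>_M by simp
      then show ?thesis using r by auto
    qed
    then show "\<exists>m. \<forall>x'. (\<forall>i<m. x' i = x i) \<longrightarrow> x' \<in> \<phi> -` U" by blast
  qed
  then have "\<phi> \<in> baire_space \<rightarrow>\<^sub>M borel_of X"
    unfolding borel_of_def X_eq using openin_subset[of mtopology]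
    by (intro measurable_measure_of)
      (auto simp: \<phi>_M sets_baire_space space_PiM intro: borel_open)
  moreover have "t \<in> range \<phi>" if t: "t \<in> M" for t
  proof -
    \<comment> \<open>With precision \<open>(1/2) ^ k / 4\<close>, consecutive approximations are
      close enough that no move is refused.\<close>
    have "\<forall>k. \<exists>n. d t (e n) < (1/2) ^ k / 4" by (intro allI dense[OF t]) simp
    from choice[OF this] obtain x where x: "\<And>k. d t (e (x k)) < (1/2) ^ k / 4" by blast
    have "y x k = e (x k)" for k
    proof (induction k)
      case (Suc k)
      have "d (e (x k)) (e (x (Suc k))) \<le> d (e (x k)) t + d t (e (x (Suc k)))"
        using e t by (simp add: triangle)
      also have "\<dots> < (1/2) ^ k / 4 + (1/2) ^ k / 4"
        using x[of k] x[of "Suc k"] nonneg[of t "e (x (Suc k))"] commute[of "e (x k)" t]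
        unfolding power_Suc by linarith
      also have "\<dots> \<le> (1/2) ^ k" by simp
      finally show ?case using Suc by (simp add: y_Suc)
    qed (simp add: y_0)
    have "d t (\<phi> x) \<le> 0"
    proof (rule field_le_epsilon)
      fix r :: real assume "r > 0"
      then obtain k where k: "4 * (1/2) ^ k < r" using small by blast
      have "d t (\<phi> x) \<le> d t (e (x k)) + d (e (x k)) (\<phi> x)"
        using e t \<phi>_M by (simp add: triangle)
      also have "\<dots> \<le> (1/2) ^ k / 4 + 2 * (1/2) ^ k"
        using x[of k] \<phi>_dist[of x k] \<open>y x k = e (x k)\<close> by simp
      also have "\<dots> \<le> 4 * (1/2) ^ k" by simp
      finally show "d t (\<phi> x) \<le> 0 + r" using k by simp
    qed
    then have "t = \<phi> x" using t \<phi>_M[of x] nonneg[of t "\<phi> x"] by simp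
    then show ?thesis by blast
  qed
  ultimately show ?thesis using \<phi>_M by (intro bexI[of _ \<phi>]) (auto simp: X_eq)
qed

text \<open>The pairing function cuts one sequence into independent sequences, one for each factor,
  so preimages can be chosen factor by factor.\<close>

lemma PiM_image_baire_space:
  fixes M :: "nat \<Rightarrow> 'a measure"
  assumes "\<And>i. i \<in> J \<Longrightarrow> \<exists>\<phi>\<in>baire_space \<rightarrow>\<^sub>M M i. range \<phi> = space (M i)"
  shows "\<exists>\<psi>\<in>baire_space \<rightarrow>\<^sub>M PiM J M. range \<psi> = space (PiM J M)"
proof -
  have "\<forall>i\<in>J. \<exists>\<phi>. \<phi> \<in> baire_space \<rightarrow>\<^sub>M M i \<and> range \<phi> = space (M i)"
    using assms by blast
  from bchoice[OF this] obtain \<phi>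
    where \<phi>: "\<And>i. i \<in> J \<Longrightarrow> \<phi> i \<in> baire_space \<rightarrow>\<^sub>M M i" "\<And>i. i \<in> J \<Longrightarrow> range (\<phi> i) = space (M i)"
    by blast
  define \<psi> where "\<psi> x = (\<lambda>i\<in>J. \<phi> i (\<lambda>k. x (prod_encode (i, k))))" for x :: "nat \<Rightarrow> nat"
  have "(\<lambda>x k. x (prod_encode (i, k))) \<in> baire_space \<rightarrow>\<^sub>M baire_space" for i :: nat
    by (intro measurable_PiM_single' measurable_component_singleton) auto
  then have "\<psi> \<in> baire_space \<rightarrow>\<^sub>M PiM J M"
    unfolding \<psi>_def[abs_def] by (intro measurable_restrict measurable_compose[OF _ \<phi>(1)])
  moreover have "z \<in> range \<psi>" if z: "z \<in> space (PiM J M)" for z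
  proof -
    have "\<forall>i\<in>J. \<exists>u. \<phi> i u = z i"
    proof
      fix i assume i: "i \<in> J"
      then have "z i \<in> range (\<phi> i)" using z \<phi>(2)[OF i] by (auto simp: space_PiM PiE_iff)
      then show "\<exists>u. \<phi> i u = z i" by auto
    qed
    from bchoice[OF this] obtain u where u: "\<forall>i\<in>J. \<phi> i (u i) = z i" ..
    define x where "x p = (case prod_decode p of (i, k) \<Rightarrow> u i k)" for p
    have "(\<lambda>k. x (prod_encode (i, k))) = u i" for i by (simp add: x_def)
    then have "\<psi> x = z"
      using u z by (auto simp: \<psi>_def fun_eq_iff space_PiM PiE_iff extensional_def)
    then show ?thesis by blast
  qed
  ultimately show ?thesis
    using measurable_space[of \<psi> baire_space "PiM J M"] by (intro bexI[of _ \<psi>]) (auto simp: space_PiM)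
qed

section \<open>The box operation\<close>

lemma (in finite_product_prob_space) measurable_cylinder_kernel:
  assumes K: "K \<subseteq> I" and A: "A \<in> sets (PiM I M)"
    and image: "\<exists>\<psi>\<in>baire_space \<rightarrow>\<^sub>M PiM (I - K) M. range \<psi> = space (PiM (I - K) M)"
  defines "A' \<equiv> {x \<in> space (PiM I M). \<forall>y\<in>space (PiM I M). (\<forall>i\<in>K. y i = x i) \<longrightarrow> y \<in> A}"
  shows "\<exists>E\<in>sets (PiM I M). \<exists>N\<in>null_sets (PiM I M). E \<subseteq> A' \<and> A' \<subseteq> E \<union> N \<and>
    (\<forall>x\<in>E. \<forall>y\<in>space (PiM I M). (\<forall>i\<in>K. x i = y i) \<longrightarrow> y \<in> E)"
proof -
  define J where "J = I - K"
  define Q where "Q = PiM K M"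
  have IJ: "K \<inter> J = {}" "K \<union> J = I" unfolding J_def using K by blast+
  obtain \<psi> where \<psi>: "\<psi> \<in> baire_space \<rightarrow>\<^sub>M PiM J M" "range \<psi> = space (PiM J M)"
    using image[folded J_def] by blast
  interpret Q: prob_space Q unfolding Q_def by (rule prob_space_PiM) (rule prob_space)
  \<comment> \<open>The coordinates outside \<open>K\<close> are coded by a sequence. The first
    projection of \<open>G\<close> then consists of the restrictions to \<open>K\<close> of points
    outside \<open>A\<close>, the obstructions to membership in \<open>A'\<close>.\<close>
  define g where "g p = merge K J (fst p, \<psi> (snd p))" for p
  have "(\<lambda>p. (fst p, \<psi> (snd p))) \<in> Q \<Otimes>\<^sub>M baire_space \<rightarrow>\<^sub>M PiM K M \<Otimes>\<^sub>M PiM J M"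
    unfolding Q_def by (intro measurable_Pair measurable_fst measurable_compose[OF measurable_snd \<psi>(1)])
  from measurable_compose[OF this measurable_merge]
  have g: "g \<in> Q \<Otimes>\<^sub>M baire_space \<rightarrow>\<^sub>M PiM I M"
    by (simp add: g_def[abs_def] IJ)
  define G where "G = g -` (space (PiM I M) - A) \<inter> space (Q \<Otimes>\<^sub>M baire_space)"
  have "G \<in> sets (Q \<Otimes>\<^sub>M baire_space)"
    unfolding G_def using A by (intro measurable_sets[OF g]) auto
  then have "fst ` G \<in> sets (completion Q)"
    by (rule measurable_projection[OF Q.finite_measure_axioms])
  then obtain S N' N where SN: "fst ` G = S \<union> N'" "N' \<subseteq> N" "N \<in> null_sets Q" "S \<in> sets Q"
    by (rule sets_completionE)
  \<comment> \<open>A measurable set covering the projection up to a null set. Its complement is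
    pulled back along the restriction to \<open>K\<close>, so \<open>E\<close> depends only on the
    coordinates in \<open>K\<close>.\<close>
  define U where "U = S \<union> N"
  have U: "U \<in> sets Q" "fst ` G \<subseteq> U" "U - fst ` G \<subseteq> N" using SN by (auto simp: U_def)
  have outside: "restrict y K \<in> fst ` G" if y: "y \<in> space (PiM I M)" "y \<notin> A" for y
  proof -
    have "restrict y J \<in> space (PiM J M)" using y by (auto simp: space_PiM PiE_iff J_def)
    then have "restrict y J \<in> range \<psi>" by (simp only: \<psi>(2))
    then obtain w where w: "restrict y J = \<psi> w" by (rule rangeE)
    have "y i = undefined" if "i \<notin> I" for i using y(1) that by (auto simp: space_PiM)
    then have "g (restrict y K, w) = y"
      using K by (auto simp: g_def merge_def fun_eq_iff J_def simp flip: w)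
    moreover have "(restrict y K, w) \<in> space (Q \<Otimes>\<^sub>M baire_space)"
      using y K by (auto simp: space_pair_measure space_PiM PiE_iff Q_def)
    ultimately have "(restrict y K, w) \<in> G" using y by (simp add: G_def)
    then show ?thesis by (rule rev_image_eqI) simp
  qed
  have inside: "\<exists>y\<in>space (PiM I M). (\<forall>i\<in>K. y i = x i) \<and> y \<notin> A" if "restrict x K \<in> fst ` G" for x
  proof -
    from that obtain p where "p \<in> G" "restrict x K = fst p" by (rule imageE)
    then obtain w where w: "(restrict x K, w) \<in> G" by (cases p) simp
    then have "g (restrict x K, w) \<in> space (PiM I M) - A" unfolding G_def by blast
    moreover have "\<forall>i\<in>K. g (restrict x K, w) i = x i" by (simp add: g_def merge_def)
    ultimately show ?thesis by blast
  qed
  have restrict: "(\<lambda>x. restrict x K) \<in> PiM I M \<rightarrow>\<^sub>M Q"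
    unfolding Q_def using K by (rule measurable_restrict_subset)
  define E where "E = (\<lambda>x. restrict x K) -` (space Q - U) \<inter> space (PiM I M)"
  define N0 where "N0 = (\<lambda>x. restrict x K) -` N \<inter> space (PiM I M)"
  have "E \<in> sets (PiM I M)"
    unfolding E_def using U by (intro measurable_sets[OF restrict]) auto
  \<comment> \<open>The restriction to \<open>K\<close> has law \<open>Q\<close>, so null sets pull
    back to null sets.\<close>
  moreover have "N0 \<in> null_sets (PiM I M)"
  proof -
    have "emeasure (PiM I M) N0 = emeasure (distr (PiM I M) Q (\<lambda>x. restrict x K)) N"
      unfolding N0_def using SN(3) by (intro emeasure_distr[symmetric] restrict) auto
    also have "distr (PiM I M) Q (\<lambda>x. restrict x K) = Q"
      unfolding Q_def using distr_restrict[OF K finite_index] by simp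
    finally show ?thesis
      using SN measurable_sets[OF restrict, of N] by (auto simp: N0_def null_sets_def)
  qed
  moreover have "E \<subseteq> A'"
  proof
    fix x assume x: "x \<in> E"
    have "y \<in> A" if y: "y \<in> space (PiM I M)" "\<forall>i\<in>K. y i = x i" for y
    proof (rule ccontr)
      assume "y \<notin> A"
      with y have "restrict y K \<in> fst ` G" by (intro outside)
      moreover have "restrict y K = restrict x K" using y by (auto simp: restrict_def)
      ultimately show False using x U by (auto simp: E_def)
    qed
    then show "x \<in> A'" using x by (auto simp: A'_def E_def)
  qed
  moreover have "A' \<subseteq> E \<union> N0"
  proof
    fix x assume x: "x \<in> A'"
    then have xs: "x \<in> space (PiM I M)" by (simp add: A'_def)
    have "restrict x K \<notin> fst ` G" using inside[of x] x unfolding A'_def by blast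
    moreover have "restrict x K \<in> space Q" using measurable_space[OF restrict xs] .
    ultimately show "x \<in> E \<union> N0" using U xs by (auto simp: E_def N0_def)
  qed
  moreover have "\<forall>x\<in>E. \<forall>y\<in>space (PiM I M). (\<forall>i\<in>K. x i = y i) \<longrightarrow> y \<in> E"
  proof (intro ballI impI)
    fix x y assume "x \<in> E" "y \<in> space (PiM I M)" "\<forall>i\<in>K. x i = y i"
    moreover from this have "restrict x K = restrict y K" by (auto simp: restrict_def)
    ultimately show "y \<in> E" by (simp add: E_def)
  qed
  ultimately show ?thesis by blast
qed

lemma (in finite_product_prob_space) bkr:
  fixes A B :: "('a \<Rightarrow> 'b) set"
  assumes A: "A \<in> sets (PiM I M)" and B: "B \<in> sets (PiM I M)"
    and image: "\<And>J. J \<subseteq> I \<Longrightarrow> \<exists>\<psi>\<in>baire_space \<rightarrow>\<^sub>M PiM J M. range \<psi> = space (PiM J M)"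
  defines "cyl \<equiv> \<lambda>K x. {y \<in> space (PiM I M). \<forall>i\<in>K. y i = x i}"
  defines "D \<equiv> {x \<in> space (PiM I M). \<exists>K L. K \<subseteq> I \<and> L \<subseteq> I \<and> K \<inter> L = {} \<and> cyl K x \<subseteq> A \<and> cyl L x \<subseteq> B}"
  shows "D \<in> sets (completion (PiM I M)) \<and>
    measure (completion (PiM I M)) D \<le> measure (PiM I M) A * measure (PiM I M) B"
proof -
  define ker where "ker C K = {x \<in> space (PiM I M). \<forall>y\<in>space (PiM I M). (\<forall>i\<in>K. y i = x i) \<longrightarrow> y \<in> C}" for C K
  define approx where "approx C K E N \<longleftrightarrow> E \<in> sets (PiM I M) \<and> N \<in> null_sets (PiM I M) \<and>
      E \<subseteq> ker C K \<and> ker C K \<subseteq> E \<union> N \<and>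
      (\<forall>x\<in>E. \<forall>y\<in>space (PiM I M). (\<forall>i\<in>K. x i = y i) \<longrightarrow> y \<in> E)" for C K E N
  have approx: "\<exists>E N. approx C K E N" if "K \<subseteq> I" "C \<in> sets (PiM I M)" for C K
    using measurable_cylinder_kernel[OF that image[of "I - K"]] unfolding approx_def ker_def by blast
  have "\<forall>K\<in>Pow I. \<exists>p. approx A K (fst p) (snd p)" using approx[OF _ A] by simp
  from bchoice[OF this] obtain p where p: "\<And>K. K \<subseteq> I \<Longrightarrow> approx A K (fst (p K)) (snd (p K))" by blast
  have "\<forall>K\<in>Pow I. \<exists>p. approx B (I - K) (fst p) (snd p)" using approx[OF _ B] by simp
  from bchoice[OF this] obtain q where q: "\<And>K. K \<subseteq> I \<Longrightarrow> approx B (I - K) (fst (q K)) (snd (q K))" by blast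
  define E where "E K = fst (p K)" for K
  define F where "F K = fst (q K)" for K
  define N where "N = (\<Union>K\<in>Pow I. snd (p K) \<union> snd (q K))"
  define D' where "D' = (\<Union>K\<in>Pow I. E K \<inter> F K)"
  have fin: "finite (Pow I)" using finite_index by simp
  have E: "E K \<in> sets (PiM I M)" "E K \<subseteq> ker A K" "ker A K \<subseteq> E K \<union> N"
    "\<And>x y. \<lbrakk>x \<in> E K; y \<in> space (PiM I M); \<forall>i\<in>K. x i = y i\<rbrakk> \<Longrightarrow> y \<in> E K" if "K \<subseteq> I" for K
    using p[OF that] that unfolding approx_def E_def N_def by blast+
  have F: "F K \<in> sets (PiM I M)" "F K \<subseteq> ker B (I - K)" "ker B (I - K) \<subseteq> F K \<union> N"
    "\<And>x y. \<lbrakk>x \<in> F K; y \<in> space (PiM I M); \<forall>i\<in>I - K. x i = y i\<rbrakk> \<Longrightarrow> y \<in> F K" if "K \<subseteq> I" for K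
    using q[OF that] that unfolding approx_def F_def N_def by blast+
  have N: "N \<in> null_sets (PiM I M)"
    unfolding N_def using fin p q
    by (intro null_sets_UN' null_sets.Un countable_finite) (auto simp: approx_def)
  have D': "D' \<in> sets (PiM I M)" using fin E F by (auto simp: D'_def intro!: sets.finite_UN)
  have cyl_ker: "cyl K x \<subseteq> C \<longleftrightarrow> x \<in> ker C K" if "x \<in> space (PiM I M)" for C K x
    using that by (auto simp: cyl_def ker_def)
  have D_eq: "D = (\<Union>K\<in>Pow I. ker A K \<inter> ker B (I - K))"
  proof (intro equalityI subsetI)
    fix x assume "x \<in> D"
    then obtain K L where KL: "x \<in> space (PiM I M)" "K \<subseteq> I" "L \<subseteq> I" "K \<inter> L = {}" "cyl K x \<subseteq> A" "cyl L x \<subseteq> B"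
      by (auto simp: D_def)
    \<comment> \<open>Fixing more coordinates shrinks the cylinder, so \<open>L\<close> may be
      enlarged to the complement of \<open>K\<close>.\<close>
    have "cyl (I - K) x \<subseteq> cyl L x" using KL by (auto simp: cyl_def)
    with KL have "x \<in> ker A K \<inter> ker B (I - K)"
      by (simp add: cyl_ker[symmetric] order_trans[of "cyl (I - K) x" "cyl L x"])
    with KL show "x \<in> (\<Union>K\<in>Pow I. ker A K \<inter> ker B (I - K))" by blast
  next
    fix x assume "x \<in> (\<Union>K\<in>Pow I. ker A K \<inter> ker B (I - K))"
    then obtain K where K: "K \<subseteq> I" "x \<in> ker A K" "x \<in> ker B (I - K)" by blast
    then have x: "x \<in> space (PiM I M)" by (simp add: ker_def)
    with K have "cyl K x \<subseteq> A" "cyl (I - K) x \<subseteq> B" by (simp_all add: cyl_ker)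
    with x K show "x \<in> D" unfolding D_def by blast
  qed
  have D_lower: "D' \<subseteq> D"
    unfolding D_eq D'_def by (intro UN_mono Int_mono E(2) F(2)) auto
  have D_upper: "D \<subseteq> D' \<union> N"
  proof
    fix x assume "x \<in> D"
    then obtain K where K: "K \<subseteq> I" "x \<in> ker A K" "x \<in> ker B (I - K)" unfolding D_eq by blast
    then have "x \<in> E K \<union> N" "x \<in> F K \<union> N" using E(3)[OF K(1)] F(3)[OF K(1)] by blast+
    then show "x \<in> D' \<union> N" using K(1) unfolding D'_def by blast
  qed
  note D = D_lower D_upper
  have "D' \<union> (D - D') \<in> sets (completion (PiM I M))"
    by (rule sets_completionI[of _ D' "D - D'" N]) (use D D' N in auto)
  then have "D \<in> sets (completion (PiM I M))" using D by (simp add: Un_absorb1)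
  moreover have "measure (completion (PiM I M)) D \<le> measure (PiM I M) A * measure (PiM I M) B"
  proof -
    interpret C: prob_space "completion (PiM I M)" by (rule prob_space_completion)
    have "measure (completion (PiM I M)) D \<le> measure (completion (PiM I M)) (D' \<union> N)"
      using D D' N by (intro C.finite_measure_mono) auto
    also have "\<dots> = measure (PiM I M) (D' \<union> N)" using D' N by (intro measure_completion) auto
    also have "\<dots> = measure (PiM I M) D'" using D' N by (rule measure_Un_null_set)
    also have "\<dots> \<le> measure (PiM I M) (\<Union>K\<in>Pow I. E K) * measure (PiM I M) (\<Union>K\<in>Pow I. F K)"
      unfolding D'_def by (rule bkr_cylinder_families) (fact E(1) F(1) E(4) F(4))+
    also have "\<dots> \<le> measure (PiM I M) A * measure (PiM I M) B"
    proof -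
      \<comment> \<open>Each point lies in its own cylinder.\<close>
      have ker: "ker C K \<subseteq> C" for C K by (auto simp: ker_def)
      have "E K \<subseteq> A" "F K \<subseteq> B" if "K \<subseteq> I" for K
        using E(2)[OF that] F(2)[OF that] ker by (meson order_trans)+
      then have "(\<Union>K\<in>Pow I. E K) \<subseteq> A" "(\<Union>K\<in>Pow I. F K) \<subseteq> B" by blast+
      then show ?thesis using A B by (intro mult_mono finite_measure_mono) auto
    qed
    finally show ?thesis .
  qed
  ultimately show ?thesis ..
qed

theorem proposition1p1:
  fixes n :: nat
    and X :: "nat \<Rightarrow> 'a topology"
    and P :: "nat \<Rightarrow> 'a measure"
    and S :: "(nat \<Rightarrow> 'a) set"
    and A B :: "(nat \<Rightarrow> 'a) set"
  assumes "\<And>i. i \<in> {1..n} \<Longrightarrow> polish_topology (X i)"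
    and "\<And>i. i \<in> {1..n} \<Longrightarrow> prob_space (P i)"
    and "\<And>i. i \<in> {1..n} \<Longrightarrow> sets (P i) = sets (borel_of (X i))"
    and "S = (\<Pi>\<^sub>E i\<in>{1..n}. topspace (X i))"
    and "A \<in> sets (\<Pi>\<^sub>M i\<in>{1..n}. borel_of (X i))"
    and "B \<in> sets (\<Pi>\<^sub>M i\<in>{1..n}. borel_of (X i))"
  shows "box_op n S A B \<in> sets (completion (\<Pi>\<^sub>M i\<in>{1..n}. P i)) \<and>
         measure (completion (\<Pi>\<^sub>M i\<in>{1..n}. P i)) (box_op n S A B)
           \<le> measure (\<Pi>\<^sub>M i\<in>{1..n}. P i) A * measure (\<Pi>\<^sub>M i\<in>{1..n}. P i) B"
proof -
  define I where "I = {1..n}"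
  \<comment> \<open>The locale requires a probability space at every index, but the assumptions
    concern \<open>{1..n}\<close> only; a point mass fills the other places.\<close>
  define M where "M i = (if i \<in> I then P i else return (count_space UNIV) undefined)" for i
  interpret finite_product_prob_space M I
  proof -
    have "product_prob_space M"
      by (rule product_prob_spaceI) (auto simp: M_def I_def assms(2) intro: prob_space_return)
    then interpret product_prob_space M I .
    show "finite_product_prob_space M I" by unfold_locales (simp add: I_def)
  qed
  have PiM_eq: "PiM I P = PiM I M"
    by (rule PiM_cong) (simp_all add: M_def)
  have sets_M: "sets (M i) = sets (borel_of (X i))" if "i \<in> I" for i
    using that assms(3) by (simp add: M_def I_def)
  have space_M: "space (M i) = topspace (X i)" if "i \<in> I" for i
    using sets_eq_imp_space_eq[OF sets_M[OF that]] by (simp add: space_borel_of)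
  have sets_PiM: "sets (\<Pi>\<^sub>M i\<in>{1..n}. borel_of (X i)) = sets (PiM I M)"
    unfolding I_def[symmetric] by (rule sets_PiM_cong) (simp_all add: sets_M)
  have image: "\<exists>\<phi>\<in>baire_space \<rightarrow>\<^sub>M M i. range \<phi> = space (M i)" if i: "i \<in> I" for i
  proof -
    \<comment> \<open>A space carrying a probability measure is nonempty, as an image of Baire space
      must be.\<close>
    have "topspace (X i) \<noteq> {}" using M.not_empty[of i] space_M[OF i] by simp
    moreover have "polish_topology (X i)" using assms(1) i unfolding I_def by blast
    ultimately obtain \<phi> where \<phi>: "\<phi> \<in> baire_space \<rightarrow>\<^sub>M borel_of (X i)" "range \<phi> = topspace (X i)"
      using polish_topology_image_baire_space[of "X i"] by blast
    have "baire_space \<rightarrow>\<^sub>M M i = baire_space \<rightarrow>\<^sub>M borel_of (X i)"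
      by (rule measurable_cong_sets) (simp_all add: sets_M i)
    then show ?thesis using \<phi> space_M[OF i] by blast
  qed
  have S_eq: "S = space (PiM I M)"
    unfolding assms(4) I_def[symmetric] space_PiM by (rule PiE_cong) (simp add: space_M)
  have "A \<in> sets (PiM I M)" "B \<in> sets (PiM I M)" using assms(5,6) unfolding sets_PiM .
  moreover have "\<exists>\<psi>\<in>baire_space \<rightarrow>\<^sub>M PiM J M. range \<psi> = space (PiM J M)" if "J \<subseteq> I" for J
    by (rule PiM_image_baire_space, rule image) (use that in blast)
  ultimately show ?thesis
    unfolding I_def[symmetric] PiM_eq box_op_def cylinder_def S_eq by (rule bkr)
qed

end
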